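(* Let $\Gamma=\mathbb{Z}^2$, let $(\mathcal{H}_0,\pi_0)$ be a representation of $\mathcal{A}_\Gamma$, and let $\alpha$ be a quasi-local automorphism of $\mathcal{A}_\Gamma$ such that for every cone $\Lambda$ there are cones $\Gamma_1\subset\Lambda\subset\Gamma_2$ such that $\alpha$ is quasi-factorizable with respect to the inclusion $\Gamma_1\subset\Lambda\subset\Gamma_2$. Suppose that a representation $\pi$ of $\mathcal{A}_\Gamma$ satisfies the superselection criterion for $\pi_0$, in the sense that for all cones $\Lambda$ in $\mathbb{Z}^2$ the representations $\pi|_{\mathcal{A}_{\Lambda^c}}$ and $\pi_0|_{\mathcal{A}_{\Lambda^c}}$ are quasi-equivalent. Then $\pi\circ\alpha$ satisfies the superselection criterion for $\pi_0\circ\alpha$, i.e. for all cones $\Lambda$ in $\mathbb{Z}^2$ the representations $\pi\circ\alpha|_{\mathcal{A}_{\Lambda^c}}$ and $\pi_0\circ\alpha|_{\mathcal{A}_{\Lambda^c}}$ are quasi-equivalent.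
   Context: Quantum spin system: each $x\in\Gamma=\mathbb{Z}^2$ carries a finite dimensional Hilbert space $\mathcal{H}_x$ with $\sup_x\dim\mathcal{H}_x<\infty$. For finite $\Lambda\subset\Gamma$, $\mathcal{A}_\Lambda=\bigotimes_{x\in\Lambda}\mathcal{B}(\mathcal{H}_x)$, with the natural inclusions; for any $\Lambda\subset\Gamma$, $\mathcal{A}_\Lambda$ is the norm closure of $\bigcup_{\Lambda_0\subset\Lambda\text{ finite}}\mathcal{A}_{\Lambda_0}$, and $\mathcal{A}_\Gamma\cong\mathcal{A}_\Lambda\otimes\mathcal{A}_{\Lambda^c}$ with $\Lambda^c=\Gamma\setminus\Lambda$. Cones: a cone is a set $\Lambda=\{x\in\mathbb{Z}^2:(x-a)\cdot e>|x-a|\cos\theta\}$ with apex $a\in\mathbb{R}^2$, axis direction a unit vector $e\in\mathbb{R}^2$, and half-opening angle $\theta\in(0,\pi/2)$. Quasi-factorizable: let $\alpha$ be an automorphism of $\mathcal{A}_\Gamma$ and $\Gamma_1\subset\Lambda\subset\Gamma_2\subset\Gamma$ an inclusion of cones. $\alpha$ is quasi-factorizable with respect to this inclusion if there are a unitary $u\in\mathcal{A}_\Gamma$, automorphisms $\alpha_\Lambda$ of $\mathcal{A}_\Lambda$ and $\alpha_{\Lambda^c}$ of $\mathcal{A}_{\Lambda^c}$, and an automorphism $\Xi$ of $\mathcal{A}_{\Gamma_2\setminus\Gamma_1}$ such that $\alpha=\operatorname{Ad}(u)\circ\widetilde\Xi\circ(\alpha_\Lambda\otimes\alpha_{\Lambda^c})$,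 where $\widetilde\Xi=\Xi\otimes\operatorname{id}_{\mathcal{A}_{(\Gamma_2\setminus\Gamma_1)^c}}$ and $\operatorname{Ad}(u)(A)=uAu^*$. Quasi-local automorphism: an automorphism $\alpha$ of $\mathcal{A}_\Gamma$ mapping strictly local observables to approximately local ones with a Lieb-Robinson type bound, i.e. there are $C,p\ge0$ and a non-increasing $G:[0,\infty)\to[0,\infty)$ with $G(r)\to0$ as $r\to\infty$ such that $\|[\alpha(A),B]\|\le C|X|^p\|A\|\|B\|G(d(X,Y))$ for all disjoint finite $X,Y\subset\Gamma$, $A\in\mathcal{A}_X$, $B\in\mathcal{A}_Y$. Two representations $\pi_1,\pi_2$ of a $C^*$-algebra $\mathcal{A}$ are quasi-equivalent if there is a $*$-isomorphism $\tau:\pi_1(\mathcal{A})''\to\pi_2(\mathcal{A})''$ with $\tau(\pi_1(A))=\pi_2(A)$ for all $A\in\mathcal{A}$. Representations are non-degenerate $*$-representations. *)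

theory Defs
  imports "HOL-Analysis.Analysis"
begin

section \<open>Complex Hilbert spaces and C*-algebras\<close>

class complex_vector = real_vector +
  fixes scaleC :: "complex \<Rightarrow> 'a \<Rightarrow> 'a"  (infixr \<open>*\<^sub>C\<close> 75)
  assumes scaleC_add_right: "c *\<^sub>C (x + y) = c *\<^sub>C x + c *\<^sub>C y"
    and scaleC_add_left: "(b + c) *\<^sub>C x = b *\<^sub>C x + c *\<^sub>C x"
    and scaleC_scaleC: "b *\<^sub>C (c *\<^sub>C x) = (b * c) *\<^sub>C x"
    and scaleC_of_real: "complex_of_real r *\<^sub>C x = r *\<^sub>R x"

text \<open>The real inner product underlying the norm is the real part of the sesquilinear form, which
  is conjugate-linear in its first argument. Together with the axioms of \<^class>\<open>real_inner\<close> this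
  makes \<open>cinner\<close> positive definite with \<open>cinner x x = (norm x)\<^sup>2\<close>.\<close>

class chilbert_space = complex_vector + real_inner + complete_space +
  fixes cinner :: "'a \<Rightarrow> 'a \<Rightarrow> complex"
  assumes cinner_commute: "cinner x y = cnj (cinner y x)"
    and cinner_add_right: "cinner x (y + z) = cinner x y + cinner x z"
    and cinner_scaleC_right: "cinner x (c *\<^sub>C y) = c * cinner x y"
    and inner_eq_Re_cinner: "inner x y = Re (cinner x y)"

text \<open>Unital C*-algebras. Complex homogeneity of the norm follows from the C*-identity.\<close>

class cstar_algebra = complex_vector + real_normed_algebra_1 + banach +
  fixes adj :: "'a \<Rightarrow> 'a"
  assumes mult_scaleC_left: "(c *\<^sub>C a) * b = c *\<^sub>C (a * b)"
    and mult_scaleC_right: "a * (c *\<^sub>C b) = c *\<^sub>C (a * b)"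
    and adj_adj: "adj (adj a) = a"
    and adj_add: "adj (a + b) = adj a + adj b"
    and adj_scaleC: "adj (c *\<^sub>C a) = cnj c *\<^sub>C adj a"
    and adj_mult: "adj (a * b) = adj b * adj a"
    and cstar_identity: "norm (adj a * a) = (norm a)\<^sup>2"

definition unitary_element :: "'a::cstar_algebra \<Rightarrow> bool" where
  "unitary_element u \<longleftrightarrow> adj u * u = 1 \<and> u * adj u = 1"

definition Ad :: "'a::cstar_algebra \<Rightarrow> 'a \<Rightarrow> 'a" where
  "Ad u a = u * a * adj u"

text \<open>\<open>S\<close> is meant to be a *-subalgebra; only the values of \<open>\<alpha>\<close> on \<open>S\<close> matter.\<close>

definition star_automorphism_on :: "'a::cstar_algebra set \<Rightarrow> ('a \<Rightarrow> 'a) \<Rightarrow> bool" where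
  "star_automorphism_on S \<alpha> \<longleftrightarrow>
     bij_betw \<alpha> S S \<and>
     (\<forall>a\<in>S. \<forall>b\<in>S. \<alpha> (a + b) = \<alpha> a + \<alpha> b) \<and>
     (\<forall>a\<in>S. \<forall>c. \<alpha> (c *\<^sub>C a) = c *\<^sub>C \<alpha> a) \<and>
     (\<forall>a\<in>S. \<forall>b\<in>S. \<alpha> (a * b) = \<alpha> a * \<alpha> b) \<and>
     (\<forall>a\<in>S. \<alpha> (adj a) = adj (\<alpha> a))"


section \<open>Operators, representations and quasi-equivalence\<close>

definition bounded_op :: "('h::chilbert_space \<Rightarrow> 'h) \<Rightarrow> bool" where
  "bounded_op T \<longleftrightarrow> bounded_linear T \<and> (\<forall>c x. T (c *\<^sub>C x) = c *\<^sub>C T x)"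

definition cadjoint :: "('h::chilbert_space \<Rightarrow> 'h) \<Rightarrow> ('h \<Rightarrow> 'h)" where
  "cadjoint T = (THE S. \<forall>x y. cinner (T x) y = cinner x (S y))"

definition commutant :: "('h::chilbert_space \<Rightarrow> 'h) set \<Rightarrow> ('h \<Rightarrow> 'h) set" where
  "commutant M = {T. bounded_op T \<and> (\<forall>A\<in>M. T \<circ> A = A \<circ> T)}"

abbreviation bicommutant :: "('h::chilbert_space \<Rightarrow> 'h) set \<Rightarrow> ('h \<Rightarrow> 'h) set" where
  "bicommutant M \<equiv> commutant (commutant M)"

definition op_star_isomorphism ::
    "('h::chilbert_space \<Rightarrow> 'h) set \<Rightarrow> ('k::chilbert_space \<Rightarrow> 'k) set
      \<Rightarrow> (('h \<Rightarrow> 'h) \<Rightarrow> ('k \<Rightarrow> 'k)) \<Rightarrow> bool" where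
  "op_star_isomorphism M N \<tau> \<longleftrightarrow>
     bij_betw \<tau> M N \<and>
     (\<forall>A\<in>M. \<forall>B\<in>M. \<tau> (\<lambda>x. A x + B x) = (\<lambda>x. \<tau> A x + \<tau> B x)) \<and>
     (\<forall>A\<in>M. \<forall>c. \<tau> (\<lambda>x. c *\<^sub>C A x) = (\<lambda>x. c *\<^sub>C \<tau> A x)) \<and>
     (\<forall>A\<in>M. \<forall>B\<in>M. \<tau> (A \<circ> B) = \<tau> A \<circ> \<tau> B) \<and>
     (\<forall>A\<in>M. \<tau> (cadjoint A) = cadjoint (\<tau> A))"

text \<open>Non-degenerate *-representations. The set \<open>{\<pi> a x}\<close> is stable under complex scalars, so its
  real linear span is its complex linear span.\<close>

definition star_representation :: "('a::cstar_algebra \<Rightarrow> 'h::chilbert_space \<Rightarrow> 'h) \<Rightarrow> bool" where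
  "star_representation \<pi> \<longleftrightarrow>
     (\<forall>a. bounded_op (\<pi> a)) \<and>
     (\<forall>a b. \<pi> (a + b) = (\<lambda>x. \<pi> a x + \<pi> b x)) \<and>
     (\<forall>c a. \<pi> (c *\<^sub>C a) = (\<lambda>x. c *\<^sub>C \<pi> a x)) \<and>
     (\<forall>a b. \<pi> (a * b) = \<pi> a \<circ> \<pi> b) \<and>
     (\<forall>a x y. cinner (\<pi> a x) y = cinner x (\<pi> (adj a) y)) \<and>
     closure (span {\<pi> a x | a x. True}) = UNIV"

text \<open>Quasi-equivalence of the restrictions of \<open>\<pi>\<^sub>1\<close> and \<open>\<pi>\<^sub>2\<close> to the subalgebra \<open>S\<close>.\<close>

definition quasi_equivalent_on ::
    "'a::cstar_algebra set \<Rightarrow> ('a \<Rightarrow> 'h::chilbert_space \<Rightarrow> 'h)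
      \<Rightarrow> ('a \<Rightarrow> 'k::chilbert_space \<Rightarrow> 'k) \<Rightarrow> bool" where
  "quasi_equivalent_on S \<pi>\<^sub>1 \<pi>\<^sub>2 \<longleftrightarrow>
     (\<exists>\<tau>. op_star_isomorphism (bicommutant (\<pi>\<^sub>1 ` S)) (bicommutant (\<pi>\<^sub>2 ` S)) \<tau> \<and>
          (\<forall>a\<in>S. \<tau> (\<pi>\<^sub>1 a) = \<pi>\<^sub>2 a))"


section \<open>Quantum spin systems on the square lattice\<close>

type_synonym site = "int \<times> int"
type_synonym spin_config = "site \<Rightarrow> nat"
type_synonym spin_matrix = "spin_config \<Rightarrow> spin_config \<Rightarrow> complex"

text \<open>In an orthonormal basis, the Hilbert space at the site \<open>x\<close> is \<open>\<complex>\<^bsup>d x\<^esup>\<close>. The tensor product of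
  these spaces over a finite region \<open>\<Lambda>\<close> has a product basis indexed by the set below, and the
  tensor product of the algebras of operators at the sites of \<open>\<Lambda>\<close> is the algebra of all matrices
  in that basis.\<close>

definition spin_configs :: "(site \<Rightarrow> nat) \<Rightarrow> site set \<Rightarrow> spin_config set" where
  "spin_configs d \<Lambda> = (\<Pi>\<^sub>E x\<in>\<Lambda>. {..<d x})"

definition spin_matrices :: "(site \<Rightarrow> nat) \<Rightarrow> site set \<Rightarrow> spin_matrix set" where
  "spin_matrices d \<Lambda> =
     {M. \<forall>\<sigma> \<tau>. M \<sigma> \<tau> \<noteq> 0 \<longrightarrow> \<sigma> \<in> spin_configs d \<Lambda> \<and> \<tau> \<in> spin_configs d \<Lambda>}"

definition spin_matrix_one :: "(site \<Rightarrow> nat) \<Rightarrow> site set \<Rightarrow> spin_matrix" where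
  "spin_matrix_one d \<Lambda> = (\<lambda>\<sigma> \<tau>. if \<sigma> = \<tau> \<and> \<sigma> \<in> spin_configs d \<Lambda> then 1 else 0)"

definition spin_matrix_mult ::
    "(site \<Rightarrow> nat) \<Rightarrow> site set \<Rightarrow> spin_matrix \<Rightarrow> spin_matrix \<Rightarrow> spin_matrix" where
  "spin_matrix_mult d \<Lambda> M N = (\<lambda>\<sigma> \<tau>. \<Sum>\<rho>\<in>spin_configs d \<Lambda>. M \<sigma> \<rho> * N \<rho> \<tau>)"

text \<open>The natural inclusion \<open>M \<mapsto> M \<otimes> 1\<close> for \<open>\<Lambda> \<subseteq> \<Lambda>'\<close>, where \<open>1\<close> acts on the sites of \<open>\<Lambda>' - \<Lambda>\<close>.\<close>

definition spin_matrix_extend ::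
    "(site \<Rightarrow> nat) \<Rightarrow> site set \<Rightarrow> site set \<Rightarrow> spin_matrix \<Rightarrow> spin_matrix" where
  "spin_matrix_extend d \<Lambda> \<Lambda>' M =
     (\<lambda>\<sigma> \<tau>. if \<sigma> \<in> spin_configs d \<Lambda>' \<and> \<tau> \<in> spin_configs d \<Lambda>' \<and> (\<forall>x\<in>\<Lambda>' - \<Lambda>. \<sigma> x = \<tau> x)
             then M (restrict \<sigma> \<Lambda>) (restrict \<tau> \<Lambda>) else 0)"

definition alg_of_region ::
    "(site \<Rightarrow> nat) \<Rightarrow> (site set \<Rightarrow> spin_matrix \<Rightarrow> 'a::cstar_algebra) \<Rightarrow> site set \<Rightarrow> 'a set" where
  "alg_of_region d \<iota> \<Lambda> =
     closure (\<Union>\<Lambda>\<^sub>0\<in>{\<Lambda>\<^sub>0. finite \<Lambda>\<^sub>0 \<and> \<Lambda>\<^sub>0 \<subseteq> \<Lambda>}. \<iota> \<Lambda>\<^sub>0 ` spin_matrices d \<Lambda>\<^sub>0)"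

text \<open>The type \<open>'a\<close> is the algebra of the whole lattice: the completion of the union of the matrix
  algebras of the finite regions along the natural inclusions, \<open>\<iota> \<Lambda>\<close> being the embedding of the
  matrix algebra of \<open>\<Lambda>\<close>. These axioms determine it up to *-isomorphism; in particular
  \<open>\<iota> \<Lambda>\<close> is isometric for the operator norm, as an injective *-homomorphism of C*-algebras.\<close>

locale spin_system =
  fixes d :: "site \<Rightarrow> nat"
    and \<iota> :: "site set \<Rightarrow> spin_matrix \<Rightarrow> 'a::cstar_algebra"
  assumes dim_pos: "d x \<ge> 1"
    and dim_bounded: "\<exists>D. \<forall>x. d x \<le> D"
    and embed_inj: "finite \<Lambda> \<Longrightarrow> inj_on (\<iota> \<Lambda>) (spin_matrices d \<Lambda>)"
    and embed_one: "finite \<Lambda> \<Longrightarrow> \<iota> \<Lambda> (spin_matrix_one d \<Lambda>) = 1"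
    and embed_add: "\<lbrakk>finite \<Lambda>; M \<in> spin_matrices d \<Lambda>; N \<in> spin_matrices d \<Lambda>\<rbrakk>
          \<Longrightarrow> \<iota> \<Lambda> (\<lambda>\<sigma> \<tau>. M \<sigma> \<tau> + N \<sigma> \<tau>) = \<iota> \<Lambda> M + \<iota> \<Lambda> N"
    and embed_scale: "\<lbrakk>finite \<Lambda>; M \<in> spin_matrices d \<Lambda>\<rbrakk>
          \<Longrightarrow> \<iota> \<Lambda> (\<lambda>\<sigma> \<tau>. c * M \<sigma> \<tau>) = c *\<^sub>C \<iota> \<Lambda> M"
    and embed_mult: "\<lbrakk>finite \<Lambda>; M \<in> spin_matrices d \<Lambda>; N \<in> spin_matrices d \<Lambda>\<rbrakk>
          \<Longrightarrow> \<iota> \<Lambda> (spin_matrix_mult d \<Lambda> M N) = \<iota> \<Lambda> M * \<iota> \<Lambda> N"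
    and embed_adj: "\<lbrakk>finite \<Lambda>; M \<in> spin_matrices d \<Lambda>\<rbrakk>
          \<Longrightarrow> \<iota> \<Lambda> (\<lambda>\<sigma> \<tau>. cnj (M \<tau> \<sigma>)) = adj (\<iota> \<Lambda> M)"
    and embed_inclusion: "\<lbrakk>finite \<Lambda>'; \<Lambda> \<subseteq> \<Lambda>'; M \<in> spin_matrices d \<Lambda>\<rbrakk>
          \<Longrightarrow> \<iota> \<Lambda>' (spin_matrix_extend d \<Lambda> \<Lambda>' M) = \<iota> \<Lambda> M"
    and alg_of_lattice: "alg_of_region d \<iota> UNIV = UNIV"


section \<open>Cones, quasi-factorizability and the superselection criterion\<close>

definition site_point :: "site \<Rightarrow> real \<times> real" where
  "site_point x = (real_of_int (fst x), real_of_int (snd x))"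

definition lattice_cone :: "real \<times> real \<Rightarrow> real \<times> real \<Rightarrow> real \<Rightarrow> site set" where
  "lattice_cone a e \<theta> =
     {x. inner (site_point x - a) e > norm (site_point x - a) * cos \<theta>}"

definition is_cone :: "site set \<Rightarrow> bool" where
  "is_cone \<Lambda> \<longleftrightarrow> (\<exists>a e \<theta>. norm e = 1 \<and> 0 < \<theta> \<and> \<theta> < pi / 2 \<and> \<Lambda> = lattice_cone a e \<theta>)"

text \<open>\<open>\<beta> = \<beta>\<^sub>1 \<otimes> \<beta>\<^sub>2\<close> along the identification of the whole algebra with the tensor product of the
  algebras of \<open>\<Lambda>\<close> and of its complement, under which \<open>a \<otimes> b\<close> is the product \<open>a * b\<close>. Such
  products span a dense subspace, so \<open>\<beta>\<close> is unique.\<close>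

definition is_tensor_automorphism ::
    "(site \<Rightarrow> nat) \<Rightarrow> (site set \<Rightarrow> spin_matrix \<Rightarrow> 'a::cstar_algebra) \<Rightarrow> site set
      \<Rightarrow> ('a \<Rightarrow> 'a) \<Rightarrow> ('a \<Rightarrow> 'a) \<Rightarrow> ('a \<Rightarrow> 'a) \<Rightarrow> bool" where
  "is_tensor_automorphism d \<iota> \<Lambda> \<beta>\<^sub>1 \<beta>\<^sub>2 \<beta> \<longleftrightarrow>
     star_automorphism_on UNIV \<beta> \<and>
     (\<forall>a\<in>alg_of_region d \<iota> \<Lambda>. \<forall>b\<in>alg_of_region d \<iota> (- \<Lambda>). \<beta> (a * b) = \<beta>\<^sub>1 a * \<beta>\<^sub>2 b)"

definition quasi_factorizable ::
    "(site \<Rightarrow> nat) \<Rightarrow> (site set \<Rightarrow> spin_matrix \<Rightarrow> 'a::cstar_algebra) \<Rightarrow> ('a \<Rightarrow> 'a)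
      \<Rightarrow> site set \<Rightarrow> site set \<Rightarrow> site set \<Rightarrow> bool" where
  "quasi_factorizable d \<iota> \<alpha> \<Gamma>\<^sub>1 \<Lambda> \<Gamma>\<^sub>2 \<longleftrightarrow>
     (\<exists>u \<alpha>\<^sub>\<Lambda> \<alpha>\<^sub>\<Lambda>\<^sub>c \<Xi> \<beta> \<Xi>'.
        unitary_element u \<and>
        star_automorphism_on (alg_of_region d \<iota> \<Lambda>) \<alpha>\<^sub>\<Lambda> \<and>
        star_automorphism_on (alg_of_region d \<iota> (- \<Lambda>)) \<alpha>\<^sub>\<Lambda>\<^sub>c \<and>
        star_automorphism_on (alg_of_region d \<iota> (\<Gamma>\<^sub>2 - \<Gamma>\<^sub>1)) \<Xi> \<and>
        is_tensor_automorphism d \<iota> \<Lambda> \<alpha>\<^sub>\<Lambda> \<alpha>\<^sub>\<Lambda>\<^sub>c \<beta> \<and>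
        is_tensor_automorphism d \<iota> (\<Gamma>\<^sub>2 - \<Gamma>\<^sub>1) \<Xi> id \<Xi>' \<and>
        \<alpha> = Ad u \<circ> \<Xi>' \<circ> \<beta>)"

text \<open>Distances between regions are Euclidean. If \<open>X\<close> or \<open>Y\<close> is empty, the value of \<^const>\<open>setdist\<close>
  is irrelevant because the commutator vanishes.\<close>

definition quasi_local_automorphism ::
    "(site \<Rightarrow> nat) \<Rightarrow> (site set \<Rightarrow> spin_matrix \<Rightarrow> 'a::cstar_algebra) \<Rightarrow> ('a \<Rightarrow> 'a) \<Rightarrow> bool" where
  "quasi_local_automorphism d \<iota> \<alpha> \<longleftrightarrow>
     star_automorphism_on UNIV \<alpha> \<and>
     (\<exists>(C::real) (p::real) (G::real \<Rightarrow> real).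
        C \<ge> 0 \<and> p \<ge> 0 \<and> (\<forall>r\<ge>0. G r \<ge> 0) \<and> antimono_on {0..} G \<and> (G \<longlongrightarrow> 0) at_top \<and>
        (\<forall>X Y. finite X \<longrightarrow> finite Y \<longrightarrow> X \<inter> Y = {} \<longrightarrow>
          (\<forall>A\<in>alg_of_region d \<iota> X. \<forall>B\<in>alg_of_region d \<iota> Y.
             norm (\<alpha> A * B - B * \<alpha> A) \<le>
               C * real (card X) powr p * norm A * norm B
                 * G (setdist (site_point ` X) (site_point ` Y)))))"

definition superselection_criterion ::
    "(site \<Rightarrow> nat) \<Rightarrow> (site set \<Rightarrow> spin_matrix \<Rightarrow> 'a::cstar_algebra)
      \<Rightarrow> ('a \<Rightarrow> 'k::chilbert_space \<Rightarrow> 'k) \<Rightarrow> ('a \<Rightarrow> 'h::chilbert_space \<Rightarrow> 'h) \<Rightarrow> bool" where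
  "superselection_criterion d \<iota> \<pi>\<^sub>0 \<pi> \<longleftrightarrow>
     (\<forall>\<Lambda>. is_cone \<Lambda> \<longrightarrow> quasi_equivalent_on (alg_of_region d \<iota> (- \<Lambda>)) \<pi> \<pi>\<^sub>0)"

end

theory Submission
  imports Defs
begin

text \<open>Write \<open>\<alpha> = Ad u \<circ> \<Xi>' \<circ> \<beta>\<close> with respect to \<open>\<Gamma>\<^sub>1 \<subseteq> \<Lambda> \<subseteq> \<Gamma>\<^sub>2\<close>. The image of the algebra of \<open>- \<Lambda>\<close> under
  \<open>\<alpha>\<close> is \<open>Ad u ` S\<close> for a set \<open>S\<close> in the algebra of \<open>- \<Gamma>\<^sub>1\<close>, on which \<open>\<pi>\<close> and \<open>\<pi>\<^sub>0\<close> are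
  quasi-equivalent. Conjugation by \<open>u\<close> is harmless, so the point is that quasi-equivalence passes to
  subsets: an isomorphism \<open>\<tau> : M \<rightarrow> N\<close> of von Neumann algebras maps the bicommutant of \<open>P \<subseteq> M\<close> onto
  that of \<open>\<tau> ` P\<close>. If \<open>L\<^sub>1, L\<^sub>2\<close> intertwine \<open>\<tau>\<close> with the identity of \<open>M\<close> and \<open>T\<close> commutes with \<open>\<tau> ` P\<close>,
  then \<open>L\<^sub>2 T L\<^sub>1\<^sup>*\<close> commutes with \<open>P\<close>, hence with every \<open>x\<close> in the bicommutant of \<open>P\<close>; this forces \<open>T\<close>
  to commute with \<open>\<tau> x\<close> because the intertwiners separate the points. They are obtained by dominating
  a vector functional of \<open>N\<close>, transported by \<open>\<tau>\<close>, by one of \<open>M\<close>, which needs neither the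
  spectral theorem nor normality of \<open>\<tau>\<close>, only its positivity.\<close>

section \<open>Hilbert spaces\<close>

text \<open>Only the inclusion of \<open>S\<close> in the algebra of
  \<open>- \<Gamma>\<^sub>1\<close> is available, so the bicommutants generated by \<open>S\<close>
  must be matched inside larger ones. The obstacle is that a commutant refers to all operators on
  the ambient Hilbert space, while \<tau> sees only \<open>M\<close> and says nothing about
  operators outside it. Intertwiners repair this: they are the pieces of the classical description
  of \<tau> as amplification, reduction and unitary equivalence, and they carry operators commuting
  with the image of \<open>P\<close> to operators commuting with \<open>P\<close>. The usual
  argument identifies bicommutants with weak closures and uses weak continuity of \<tau>; here
  everything stays at the level of commutants. Positivity of \<tau> is read off from the inverses of
  \<open>A + \<epsilon>\<close>. On the side of the spin system, images of regions are computed on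
  local elements and extended to the closure, because automorphisms are contractive.\<close>

lemma inner_scaleC_right:
  fixes x y :: "'h::chilbert_space"
  shows "inner x (c *\<^sub>C y) = inner (cnj c *\<^sub>C x) y"
proof -
  have "cinner x (c *\<^sub>C y) = cinner (cnj c *\<^sub>C x) y"
    using cinner_commute[of "cnj c *\<^sub>C x" y] cinner_commute[of x y]
    by (simp add: cinner_scaleC_right)
  then show ?thesis
    by (simp add: inner_eq_Re_cinner)
qed

text \<open>Multiplication by -\<i> moves the imaginary part of the form into its real part. Hence
  real identities for complex-linear operators, the form in which Riesz vectors and adjoints arise
  below, lift to \<open>cinner\<close>.\<close>

lemma cinner_eq_Complex:
  fixes x y :: "'h::chilbert_space"
  shows "cinner x y = Complex (inner x y) (inner x ((- \<i>) *\<^sub>C y))"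
  by (simp add: inner_eq_Re_cinner cinner_scaleC_right complex_eq_iff)

lemma scaleC_one [simp]: "1 *\<^sub>C x = (x :: 'v::complex_vector)"
  using scaleC_of_real[of 1 x] by simp

lemma scaleC_zero_left [simp]: "0 *\<^sub>C x = (0 :: 'v::complex_vector)"
  using scaleC_of_real[of 0 x] by simp

lemma scaleC_zero_right [simp]: "c *\<^sub>C 0 = (0 :: 'v::complex_vector)"
  using scaleC_add_right[of c 0 "0::'v"] by simp

lemma scaleC_diff_right: "c *\<^sub>C (x - y) = c *\<^sub>C x - c *\<^sub>C (y :: 'v::complex_vector)"
  using scaleC_add_right[of c "x - y" y] by (simp add: algebra_simps)

lemma scaleR_scaleC: "c *\<^sub>C (r *\<^sub>R x) = r *\<^sub>R (c *\<^sub>C (x :: 'v::complex_vector))"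
  by (metis mult.commute scaleC_of_real scaleC_scaleC)

lemma norm_scaleC: "norm (c *\<^sub>C x) = cmod c * norm (x :: 'h::chilbert_space)"
proof -
  have "(norm (c *\<^sub>C x))\<^sup>2 = inner ((cnj c * c) *\<^sub>C x) x"
    by (simp add: power2_norm_eq_inner inner_scaleC_right scaleC_scaleC)
  also have "cnj c * c = complex_of_real ((cmod c)\<^sup>2)"
    by (metis complex_norm_square mult.commute)
  finally have "(norm (c *\<^sub>C x))\<^sup>2 = (cmod c * norm x)\<^sup>2"
    by (simp only: scaleC_of_real inner_scaleR_left power2_norm_eq_inner power_mult_distrib)
  then show ?thesis
    by (simp add: power2_eq_iff_nonneg)
qed

lemma bounded_linear_scaleC: "bounded_linear (\<lambda>x. c *\<^sub>C (x :: 'h::chilbert_space))"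
  by (rule bounded_linear_intro[where K = "cmod c"])
    (simp_all add: scaleC_add_right scaleR_scaleC norm_scaleC)

text \<open>The representing vector is the limit of a minimising sequence of \<open>\<parallel>w\<parallel>\<^sup>2 - 2 f w\<close>, which is
  Cauchy by the parallelogram law.\<close>

lemma riesz_on_subspace:
  fixes W :: "'a::{real_inner, complete_space} set"
  assumes W: "subspace W"
    and add: "\<And>v w. v \<in> W \<Longrightarrow> w \<in> W \<Longrightarrow> f (v + w) = f v + f w"
    and scale: "\<And>r w. w \<in> W \<Longrightarrow> f (r *\<^sub>R w) = r * f w"
    and bound: "\<And>w. w \<in> W \<Longrightarrow> \<bar>f w\<bar> \<le> C * norm w"
  shows "\<exists>y\<in>closure W. \<forall>w\<in>W. inner y w = f w"
proof -
  define J where "J w = (norm w)\<^sup>2 - 2 * f w" for w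
  define I where "I = Inf (J ` W)"
  have ne: "J ` W \<noteq> {}"
    using subspace_0[OF W] by auto
  have "- C\<^sup>2 \<le> J w" if "w \<in> W" for w
  proof -
    have "0 \<le> (norm w - C)\<^sup>2"
      by simp
    also have "\<dots> = (norm w)\<^sup>2 - 2 * (C * norm w) + C\<^sup>2"
      by (simp add: power2_eq_square algebra_simps)
    also have "\<dots> \<le> J w + C\<^sup>2"
      using bound[OF that] unfolding J_def by linarith
    finally show ?thesis
      by linarith
  qed
  then have bdd: "bdd_below (J ` W)"
    by (auto intro!: bdd_belowI[where m = "- C\<^sup>2"])
  have I_le: "I \<le> J w" if "w \<in> W" for w
    unfolding I_def using that bdd by (auto intro: cInf_lower)
  have "\<exists>w\<in>W. J w < I + 1 / Suc n" for n
    using cInf_lessD[OF ne, of "I + 1 / Suc n"] by (auto simp: I_def)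
  then obtain w where w: "\<And>n. w n \<in> W" and Jw: "\<And>n. J (w n) < I + 1 / Suc n"
    by metis
  \<comment> \<open>The linear terms of \<open>J\<close> cancel, so bounding the value at the
    midpoint below by \<open>I\<close> controls the distance.\<close>
  have parallelogram: "(norm (u - v))\<^sup>2 = 2 * J u + 2 * J v - 4 * J ((1/2) *\<^sub>R (u + v))"
    if "u \<in> W" "v \<in> W" for u v
    unfolding J_def power2_norm_eq_inner scale[OF subspace_add[OF W that]] add[OF that]
    by (simp add: inner_add_left inner_add_right inner_diff_left inner_diff_right inner_commute
        field_simps)
  have dist: "(norm (w m - w n))\<^sup>2 \<le> 2 * (1 / Suc m) + 2 * (1 / Suc n)" for m n
    using parallelogram[OF w w, of m n] Jw[of m] Jw[of n]
      I_le[OF subspace_scale[OF W subspace_add[OF W w w]], of "1/2" m n] by linarith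
  have "Cauchy w"
  proof (rule metric_CauchyI)
    fix e :: real
    assume "e > 0"
    obtain N :: nat where "4 / e\<^sup>2 < real N"
      using reals_Archimedean2 by blast
    then have N: "4 / e\<^sup>2 < real (Suc N)"
      by simp
    have "dist (w m) (w n) < e" if "m \<ge> N" "n \<ge> N" for m n
    proof -
      have "1 / real (Suc m) \<le> 1 / Suc N" "1 / real (Suc n) \<le> 1 / Suc N"
        using that by (simp_all add: frac_le)
      with dist[of m n] have "(norm (w m - w n))\<^sup>2 \<le> 4 * (1 / Suc N)"
        by linarith
      also have "\<dots> < e\<^sup>2"
        using N \<open>e > 0\<close> by (simp add: field_simps)
      finally show ?thesis
        using \<open>e > 0\<close> by (simp add: dist_norm power_less_imp_less_base)
    qed
    then show "\<exists>M. \<forall>m\<ge>M. \<forall>n\<ge>M. dist (w m) (w n) < e"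
      by blast
  qed
  then obtain y where y: "w \<longlonglongrightarrow> y"
    using Cauchy_convergent convergent_def by blast
  have "y \<in> closure W"
    using y w closure_sequential by blast
  moreover have "inner y u = f u" if u: "u \<in> W" for u
  proof -
    have quad: "0 \<le> 2 * t * (inner y u - f u) + t\<^sup>2 * (norm u)\<^sup>2" for t
    proof -
      have low: "- (1 / Suc n) \<le> 2 * t * (inner (w n) u - f u) + t\<^sup>2 * (norm u)\<^sup>2" for n
      proof -
        have "I \<le> J (w n + t *\<^sub>R u)"
          by (intro I_le subspace_add[OF W] w subspace_scale[OF W] u)
        also have "\<dots> = J (w n) + (2 * t * (inner (w n) u - f u) + t\<^sup>2 * (norm u)\<^sup>2)"
          unfolding J_def power2_norm_eq_inner using u w subspace_scale[OF W u]
          by (simp add: add scale inner_add_left inner_add_right inner_commute power2_eq_square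
              algebra_simps)
        finally show ?thesis
          using Jw[of n] by linarith
      qed
      have lim0: "(\<lambda>n. - (1 / real (Suc n))) \<longlonglongrightarrow> - 0"
        using LIMSEQ_Suc[OF lim_1_over_n] by (intro tendsto_minus) simp
      have lim: "(\<lambda>n. 2 * t * (inner (w n) u - f u) + t\<^sup>2 * (norm u)\<^sup>2)
          \<longlonglongrightarrow> 2 * t * (inner y u - f u) + t\<^sup>2 * (norm u)\<^sup>2"
        by (intro tendsto_intros y)
      have "- 0 \<le> 2 * t * (inner y u - f u) + t\<^sup>2 * (norm u)\<^sup>2"
        by (rule LIMSEQ_le[OF lim0 lim]) (use low in blast)
      then show ?thesis
        by simp
    qed
    show ?thesis
    proof (cases "u = 0")
      case True
      then show ?thesis
        using scale[OF u, of 0] by simp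
    next
      case False
      define r where "r = inner y u - f u"
      \<comment> \<open>The quadratic \<open>quad\<close> is taken at its minimum point
        \<open>t = - r / (norm u)\<^sup>2\<close>, where its value is negative unless
        \<open>r = 0\<close>.\<close>
      have "0 \<le> 2 * (- r / (norm u)\<^sup>2) * r + (- r / (norm u)\<^sup>2)\<^sup>2 * (norm u)\<^sup>2"
        using quad unfolding r_def .
      also have "\<dots> = - (r\<^sup>2 / (norm u)\<^sup>2)"
        using False by (simp add: field_simps power2_eq_square)
      finally have "r = 0"
        using False by (simp add: divide_le_0_iff)
      then show ?thesis
        by (simp add: r_def)
    qed
  qed
  ultimately show ?thesis
    by blast
qed

lemma closure_subspace:
  fixes W :: "'a::real_normed_vector set"
  assumes W: "subspace W"
  shows "subspace (closure W)"
proof (rule subspaceI)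
  show "0 \<in> closure W"
    using subspace_0[OF W] closure_subset by blast
next
  fix x y
  assume "x \<in> closure W" "y \<in> closure W"
  then obtain f g where fg: "\<And>n::nat. f n \<in> W" "f \<longlonglongrightarrow> x" "\<And>n::nat. g n \<in> W" "g \<longlonglongrightarrow> y"
    unfolding closure_sequential by blast
  then have "(\<lambda>n. f n + g n) \<longlonglongrightarrow> x + y" "f n + g n \<in> W" for n
    using subspace_add[OF W] by (simp_all add: tendsto_add)
  then show "x + y \<in> closure W"
    unfolding closure_sequential by (intro exI[of _ "\<lambda>n. f n + g n"]) simp
next
  fix c x
  assume "x \<in> closure W"
  then obtain f where "\<And>n::nat. f n \<in> W" "f \<longlonglongrightarrow> x"
    unfolding closure_sequential by blast
  then have "(\<lambda>n. c *\<^sub>R f n) \<longlonglongrightarrow> c *\<^sub>R x" "c *\<^sub>R f n \<in> W" for n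
    using subspace_scale[OF W] by (simp_all add: tendsto_scaleR)
  then show "c *\<^sub>R x \<in> closure W"
    unfolding closure_sequential by (intro exI[of _ "\<lambda>n. c *\<^sub>R f n"]) simp
qed

text \<open>Uniqueness of the Riesz vector: \<open>x - y\<close> lies in the closure of
  \<open>W\<close> and is orthogonal to it. Linearity and intertwining of maps defined through
  \<open>riesz_on_subspace\<close> reduce to checks against \<open>W\<close>.\<close>

lemma closure_eqI_inner:
  fixes x y :: "'a::real_inner"
  assumes "subspace W" "x \<in> closure W" "y \<in> closure W" "\<And>w. w \<in> W \<Longrightarrow> inner x w = inner y w"
  shows "x = y"
proof -
  have "W \<subseteq> {w. inner (x - y) w = 0}"
    using assms(4) by (auto simp: inner_diff_left)
  then have "closure W \<subseteq> {w. inner (x - y) w = 0}"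
    by (intro closure_minimal closed_Collect_eq continuous_intros)
  moreover have "x - y \<in> closure W"
    using assms subspace_diff[OF closure_subspace] by blast
  ultimately show ?thesis
    by auto
qed

text \<open>Riesz on the whole space, applied to \<open>\<lambda>x. inner y (V x)\<close>. Domain
  and codomain may differ, unlike for \<open>cadjoint\<close>, because the intertwiners map between
  two Hilbert spaces.\<close>

lemma adjoint_exists:
  fixes V :: "'a::{real_inner, complete_space} \<Rightarrow> 'b::real_inner"
  assumes V: "bounded_linear V"
  obtains W where "bounded_linear W" "\<And>x y. inner (V x) y = inner x (W y)"
proof -
  interpret V: bounded_linear V by fact
  obtain B where B: "B > 0" "\<And>x. norm (V x) \<le> norm x * B"
    using V.pos_bounded by blast
  have bd: "\<bar>inner y (V x)\<bar> \<le> norm y * B * norm x" for x y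
    using Cauchy_Schwarz_ineq2[of y "V x"] mult_left_mono[OF B(2)[of x], of "norm y"]
    by (simp add: ac_simps)
  have "\<exists>z\<in>closure UNIV. \<forall>x\<in>UNIV. inner z x = inner y (V x)" for y
    by (rule riesz_on_subspace[where C = "norm y * B"])
      (simp_all add: V.add V.scaleR inner_add_right bd)
  then obtain W where W: "\<And>x y. inner (W y) x = inner y (V x)"
    by (metis UNIV_I)
  have lin: "W (x + y) = W x + W y" "W (r *\<^sub>R x) = r *\<^sub>R W x" for x y r
    by (rule iffD1[OF vector_eq_rdot], simp add: W inner_add_left)+
  have "norm (W y) \<le> norm y * B" for y
  proof (cases "W y = 0")
    case False
    have "norm (W y) * norm (W y) = inner y (V (W y))"
      unfolding W[symmetric] by (simp add: power2_norm_eq_inner flip: power2_eq_square)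
    also have "\<dots> \<le> norm y * B * norm (W y)"
      using bd[of y "W y"] by linarith
    finally show ?thesis
      using False by simp
  qed (use B in simp)
  then have "bounded_linear W"
    by (intro bounded_linear_intro[where K = B] lin)
  then show ?thesis
    using that[of W] by (simp add: inner_commute[of _ "W _"] inner_commute[of "V _"] W)
qed

lemma adjoint_scaleC:
  fixes V :: "'a::chilbert_space \<Rightarrow> 'b::chilbert_space"
  assumes "\<And>c x. V (c *\<^sub>C x) = c *\<^sub>C V x" "\<And>x y. inner (V x) y = inner x (W y)"
  shows "W (c *\<^sub>C y) = c *\<^sub>C W y"
proof -
  have "inner x (W (c *\<^sub>C y)) = inner x (c *\<^sub>C W y)" for x
    by (simp only: assms(2)[symmetric] inner_scaleC_right[of _ c] assms(1)[symmetric])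
  then show ?thesis
    by (rule iffD1[OF vector_eq_ldot, OF allI])
qed

section \<open>Bounded operators and commutants\<close>

lemma bounded_op_id: "bounded_op id"
  by (simp add: bounded_op_def bounded_linear_ident id_def)

lemma bounded_op_comp: "bounded_op A \<Longrightarrow> bounded_op B \<Longrightarrow> bounded_op (A \<circ> B)"
  by (simp add: bounded_op_def bounded_linear_compose comp_def)

lemma bounded_op_add: "bounded_op A \<Longrightarrow> bounded_op B \<Longrightarrow> bounded_op (\<lambda>x. A x + B x)"
  by (simp add: bounded_op_def bounded_linear_add scaleC_add_right)

lemma bounded_op_scale: "bounded_op A \<Longrightarrow> bounded_op (\<lambda>x. c *\<^sub>C A x)"
  by (simp add: bounded_op_def bounded_linear_compose[OF bounded_linear_scaleC] scaleC_scaleC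
      mult.commute)

text \<open>Complex linearity of \<open>T\<close> upgrades the real adjoint relation to the
  sesquilinear one in the definition of \<open>cadjoint\<close>; all later work with adjoints can
  then use \<open>inner\<close> alone.\<close>

lemma cadjoint_eqI:
  assumes "bounded_op T" and T: "\<And>x y. inner (T x) y = inner x (S y)"
  shows "cadjoint T = S"
proof -
  have hom: "T (c *\<^sub>C x) = c *\<^sub>C T x" for c x
    using assms(1) by (simp add: bounded_op_def)
  have S: "cinner (T x) y = cinner x (S y)" for x y
    by (simp only: cinner_eq_Complex T adjoint_scaleC[OF hom T])
  show ?thesis
    unfolding cadjoint_def
  proof (rule the_equality)
    fix S'
    assume S': "\<forall>x y. cinner (T x) y = cinner x (S' y)"
    have "inner x (S' y) = inner x (S y)" for x y
      using S S' by (simp add: inner_eq_Re_cinner)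
    then show "S' = S"
      by (intro ext) (rule iffD1[OF vector_eq_ldot], simp)
  qed (use S in blast)
qed

lemma
  assumes "bounded_op T"
  shows bounded_op_cadjoint: "bounded_op (cadjoint T)"
    and inner_cadjoint: "inner (T x) y = inner x (cadjoint T y)"
proof -
  obtain S where S: "bounded_linear S" "\<And>x y. inner (T x) y = inner x (S y)"
    using adjoint_exists assms unfolding bounded_op_def by metis
  have "cadjoint T = S"
    using cadjoint_eqI assms S(2) by blast
  then show "bounded_op (cadjoint T)" "inner (T x) y = inner x (cadjoint T y)"
    using S adjoint_scaleC[of T S] assms by (auto simp: bounded_op_def)
qed

lemma cadjoint_cadjoint:
  assumes "bounded_op T"
  shows "cadjoint (cadjoint T) = T"
proof (rule cadjoint_eqI)
  show "inner (cadjoint T x) y = inner x (T y)" for x y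
    using inner_cadjoint[OF assms, of y x] inner_commute[of "cadjoint T x" y] inner_commute[of x "T y"]
    by (simp only:)
qed (rule bounded_op_cadjoint[OF assms])

lemma cadjoint_comp:
  assumes "bounded_op A" "bounded_op B"
  shows "cadjoint (A \<circ> B) = cadjoint B \<circ> cadjoint A"
  by (rule cadjoint_eqI)
    (simp_all only: bounded_op_comp assms comp_apply inner_cadjoint[OF assms(1)]
      inner_cadjoint[OF assms(2)])

lemma commutant_bounded: "T \<in> commutant M \<Longrightarrow> bounded_op T"
  by (simp add: commutant_def)

lemma commutant_commute: "T \<in> commutant M \<Longrightarrow> A \<in> M \<Longrightarrow> T (A x) = A (T x)"
  by (auto simp: commutant_def fun_eq_iff)

lemma commutantI: "bounded_op T \<Longrightarrow> (\<And>A x. A \<in> M \<Longrightarrow> T (A x) = A (T x)) \<Longrightarrow> T \<in> commutant M"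
  by (auto simp: commutant_def)

lemma commutant_antimono: "M \<subseteq> N \<Longrightarrow> commutant N \<subseteq> commutant M"
  by (auto simp: commutant_def)

lemma subset_bicommutant: "(\<And>A. A \<in> M \<Longrightarrow> bounded_op A) \<Longrightarrow> M \<subseteq> bicommutant M"
  by (auto simp: commutant_def)

lemma commutant_bicommutant:
  assumes "\<And>A. A \<in> M \<Longrightarrow> bounded_op A"
  shows "commutant (bicommutant M) = commutant M"
proof
  show "commutant (bicommutant M) \<subseteq> commutant M"
    by (intro commutant_antimono subset_bicommutant assms)
  show "commutant M \<subseteq> commutant (bicommutant M)"
    by (intro subset_bicommutant) (rule commutant_bounded)
qed

lemma id_in_commutant: "id \<in> commutant M"
  by (simp add: commutant_def bounded_op_id)

lemma commutant_comp: "A \<in> commutant M \<Longrightarrow> B \<in> commutant M \<Longrightarrow> A \<circ> B \<in> commutant M"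
  by (auto simp: commutant_def bounded_op_comp fun_eq_iff)

lemma commutant_add:
  assumes "\<And>A. A \<in> M \<Longrightarrow> bounded_op A" "A \<in> commutant M" "B \<in> commutant M"
  shows "(\<lambda>x. A x + B x) \<in> commutant M"
proof (rule commutantI)
  fix C x
  assume C: "C \<in> M"
  then interpret bounded_linear C
    using assms(1) by (auto simp: bounded_op_def)
  show "A (C x) + B (C x) = C (A x + B x)"
    by (simp add: commutant_commute[OF assms(2) C] commutant_commute[OF assms(3) C] add)
qed (use assms in \<open>simp add: bounded_op_add commutant_bounded\<close>)

lemma commutant_scale:
  assumes "\<And>A. A \<in> M \<Longrightarrow> bounded_op A" "A \<in> commutant M"
  shows "(\<lambda>x. c *\<^sub>C A x) \<in> commutant M"
proof (rule commutantI)
  show "bounded_op (\<lambda>x. c *\<^sub>C A x)"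
    using assms commutant_bounded bounded_op_scale by blast
  show "c *\<^sub>C A (B x) = B (c *\<^sub>C A x)" if "B \<in> M" for B x
    using assms that by (simp add: commutant_commute[OF assms(2) that] bounded_op_def)
qed

lemma commutant_cadjoint:
  assumes M: "\<And>A. A \<in> M \<Longrightarrow> bounded_op A" "\<And>A. A \<in> M \<Longrightarrow> cadjoint A \<in> M"
    and T: "T \<in> commutant M"
  shows "cadjoint T \<in> commutant M"
proof (rule commutantI)
  note b = commutant_bounded[OF T]
  show "bounded_op (cadjoint T)"
    by (rule bounded_op_cadjoint[OF b])
  fix A x
  assume A: "A \<in> M"
  have "cadjoint T \<circ> A = cadjoint (cadjoint A \<circ> T)"
    by (simp only: cadjoint_comp[OF M(1)[OF M(2)[OF A]] b] cadjoint_cadjoint[OF M(1)[OF A]])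
  also have "cadjoint A \<circ> T = T \<circ> cadjoint A"
    using T M(2)[OF A] by (auto simp: commutant_def)
  also have "cadjoint (T \<circ> cadjoint A) = A \<circ> cadjoint T"
    by (simp only: cadjoint_comp[OF b M(1)[OF M(2)[OF A]]] cadjoint_cadjoint[OF M(1)[OF A]])
  finally show "cadjoint T (A x) = A (cadjoint T x)"
    by (simp only: comp_def fun_eq_iff)
qed

section \<open>Positive operators\<close>

text \<open>Since \<open>inner\<close> is only the real part of the complex form, the inequality
  does not imply symmetry: multiplication by \<i> satisfies it with value 0. Hence the separate
  symmetry clause.\<close>

definition pos_op :: "('h::chilbert_space \<Rightarrow> 'h) \<Rightarrow> bool" where
  "pos_op A \<longleftrightarrow> bounded_op A \<and> (\<forall>x y. inner (A x) y = inner x (A y)) \<and> (\<forall>x. 0 \<le> inner (A x) x)"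

lemma pos_opD:
  assumes "pos_op A"
  shows "bounded_op A" "inner (A x) y = inner x (A y)" "0 \<le> inner (A x) x"
  using assms by (auto simp: pos_op_def)

lemma bounded_opD:
  assumes "bounded_op A"
  shows "bounded_linear A" "A (x + y) = A x + A y" "A (x - y) = A x - A y"
    "A (r *\<^sub>R x) = r *\<^sub>R A x" "A (c *\<^sub>C x) = c *\<^sub>C A x" "A 0 = 0"
  using assms unfolding bounded_op_def
  by (auto simp: linear_simps bounded_linear.linear linear_0)

lemma bounded_op_diff: "bounded_op A \<Longrightarrow> bounded_op B \<Longrightarrow> bounded_op (\<lambda>x. A x - B x)"
  by (simp add: bounded_op_def bounded_linear_sub scaleC_diff_right)

lemma bounded_op_scaleR: "bounded_op A \<Longrightarrow> bounded_op (\<lambda>x. r *\<^sub>R A x)"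
  using bounded_op_scale[of A "complex_of_real r"] by (simp only: scaleC_of_real)

lemma bounded_op_zero: "bounded_op (\<lambda>x. 0)"
  by (simp add: bounded_op_def)

lemma bounded_op_bound:
  assumes "bounded_op A"
  obtains K where "K > 0" "\<And>x. norm (A x) \<le> K * norm x" "\<And>x. inner (A x) x \<le> K * (norm x)\<^sup>2"
proof -
  obtain K where K: "K > 0" "\<And>x. norm (A x) \<le> norm x * K"
    using bounded_linear.pos_bounded[OF bounded_opD(1)[OF assms]] by blast
  have "inner (A x) x \<le> K * (norm x)\<^sup>2" for x
  proof -
    have "inner (A x) x \<le> norm (A x) * norm x"
      by (rule norm_cauchy_schwarz)
    also have "\<dots> \<le> (norm x * K) * norm x"
      by (intro mult_right_mono K) simp
    finally show ?thesis
      by (simp add: power2_eq_square ac_simps)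
  qed
  then show thesis
    using that[of K] K by (simp add: mult.commute)
qed

lemma pos_op_add: "pos_op A \<Longrightarrow> pos_op B \<Longrightarrow> pos_op (\<lambda>x. A x + B x)"
  unfolding pos_op_def by (auto simp only: bounded_op_add inner_add_left inner_add_right add_nonneg_nonneg)

lemma pos_op_zero: "pos_op (\<lambda>x. 0)"
  by (simp add: pos_op_def bounded_op_zero)

text \<open>The Cauchy-Schwarz inequality for the form \<open>\<lambda>x y. inner (A x) y\<close>, applied to \<open>x\<close> and \<open>A x\<close>.\<close>

lemma pos_op_norm_le:
  assumes A: "pos_op A" and K: "K > 0" "\<And>x. inner (A x) x \<le> K * (norm x)\<^sup>2"
  shows "(norm (A x))\<^sup>2 \<le> K * inner (A x) x"
proof -
  note lin = bounded_opD[OF pos_opD(1)[OF A]]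
  define t where "t = 1 / K"
  have "0 \<le> inner (A (x - t *\<^sub>R A x)) (x - t *\<^sub>R A x)"
    by (rule pos_opD(3)[OF A])
  also have "\<dots> = inner (A x) x - 2 * t * (norm (A x))\<^sup>2 + t\<^sup>2 * inner (A (A x)) (A x)"
    using pos_opD(2)[OF A, of "A x" x]
    by (simp add: lin(3,4) inner_diff_left inner_diff_right power2_norm_eq_inner
        power2_eq_square[of t] algebra_simps)
  also have "\<dots> \<le> inner (A x) x - 2 * t * (norm (A x))\<^sup>2 + t\<^sup>2 * (K * (norm (A x))\<^sup>2)"
    by (intro add_left_mono mult_left_mono K(2)) simp
  also have "\<dots> = inner (A x) x - (norm (A x))\<^sup>2 / K"
    using K(1) by (simp add: t_def field_simps power2_eq_square)
  finally show ?thesis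
    using K(1) by (simp add: field_simps)
qed

section \<open>Strong limits of positive operators and domination by a vector functional\<close>

lemma pos_op_lim:
  assumes c: "\<And>n. pos_op (c n)" and lim: "\<And>x. (\<lambda>n. c n x) \<longlonglongrightarrow> b x"
    and bound: "\<And>n x. norm (c n x) \<le> K * norm x"
  shows "pos_op b"
proof -
  note op = pos_opD(1)[OF c]
  have add: "b (x + y) = b x + b y" for x y
    using tendsto_add[OF lim[of x] lim[of y]] lim[of "x + y"]
    by (simp add: bounded_opD(2)[OF op] LIMSEQ_unique)
  have scale: "b (r *\<^sub>R x) = r *\<^sub>R b x" for r x
    using tendsto_scaleR[OF tendsto_const lim[of x], of r] lim[of "r *\<^sub>R x"]
    by (simp add: bounded_opD(4)[OF op] LIMSEQ_unique)
  have scaleC: "b (r *\<^sub>C x) = r *\<^sub>C b x" for r x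
    using bounded_linear.tendsto[OF bounded_linear_scaleC lim[of x], of r] lim[of "r *\<^sub>C x"]
    by (simp add: bounded_opD(5)[OF op] LIMSEQ_unique)
  have "norm (b x) \<le> norm x * K" for x
    by (rule LIMSEQ_le_const2[OF tendsto_norm[OF lim]])
      (use bound in \<open>auto simp: mult.commute\<close>)
  then have "bounded_op b"
    unfolding bounded_op_def using bounded_linear_intro[of b K] add scale scaleC by blast
  moreover have "inner (b x) y = inner x (b y)" for x y
  proof -
    have "(\<lambda>n. inner (c n x) y) \<longlonglongrightarrow> inner (b x) y"
      by (intro tendsto_inner lim tendsto_const)
    moreover have "(\<lambda>n. inner (c n x) y) \<longlonglongrightarrow> inner x (b y)"
      unfolding pos_opD(2)[OF c] by (intro tendsto_inner lim tendsto_const)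
    ultimately show ?thesis
      by (rule LIMSEQ_unique)
  qed
  moreover have "0 \<le> inner (b x) x" for x
  proof -
    have "(\<lambda>n. inner (c n x) x) \<longlonglongrightarrow> inner (b x) x"
      by (intro tendsto_inner lim tendsto_const)
    then show ?thesis
      by (rule LIMSEQ_le_const) (use pos_opD(3)[OF c] in blast)
  qed
  ultimately show ?thesis
    unfolding pos_op_def by blast
qed

text \<open>The real sequence \<open>inner (a n x) x\<close> is increasing and bounded, hence
  Cauchy. The differences of the \<open>a n\<close> lie below \<open>e\<close> and so share the
  bound \<open>K\<close>; by \<open>pos_op_norm_le\<close> this makes \<open>a n x\<close> itself
  Cauchy. Commutation with \<open>Q\<close> survives pointwise limits.\<close>

lemma pos_op_monotone_limit:
  assumes Q: "\<And>A. A \<in> Q \<Longrightarrow> bounded_op A" and a: "\<And>n. a n \<in> commutant Q" "\<And>n. pos_op (a n)"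
    and inc: "\<And>n. pos_op (\<lambda>x. a (Suc n) x - a n x)"
    and e: "bounded_op e" and le: "\<And>n. pos_op (\<lambda>x. e x - a n x)"
  obtains b where "b \<in> commutant Q" "pos_op b" "\<And>n. pos_op (\<lambda>x. b x - a n x)"
    "pos_op (\<lambda>x. e x - b x)" "\<And>x. (\<lambda>n. a n x) \<longlonglongrightarrow> b x"
proof -
  obtain K where K: "K > 0" "\<And>x. norm (e x) \<le> K * norm x" "\<And>x. inner (e x) x \<le> K * (norm x)\<^sup>2"
    by (rule bounded_op_bound[OF e]) (rule that)
  have diff: "pos_op (\<lambda>x. a (k + n) x - a n x)" for k n
  proof (induction k)
    case 0
    then show ?case
      by (simp add: pos_op_zero)
  next
    case (Suc k)
    show ?case
      using pos_op_add[OF inc[of "k + n"] Suc.IH] by simp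
  qed
  have a_le: "inner (a n x) x \<le> inner (e x) x" for n x
    using pos_opD(3)[OF le[of n], of x] by (simp add: inner_diff_left)
  have a_ge: "0 \<le> inner (a n x) x" for n x
    by (rule pos_opD(3)[OF a(2)])
  have form_le: "inner (a (k + n) x - a n x) x \<le> K * (norm x)\<^sup>2" for k n x
    using a_le[of "k + n" x] a_ge[of n x] K(3)[of x] by (simp add: inner_diff_left)
  have sq: "(norm (a (k + n) x - a n x))\<^sup>2 \<le> K * (inner (a (k + n) x) x - inner (a n x) x)" for k n x
    using pos_op_norm_le[OF diff K(1) form_le, of k n x] by (simp add: inner_diff_left)
  have "Cauchy (\<lambda>n. a n x)" for x
  proof (rule metric_CauchyI)
    fix r :: real
    assume r: "r > 0"
    have "incseq (\<lambda>n. inner (a n x) x)"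
      using pos_opD(3)[OF inc, of _ x] by (intro incseq_SucI) (simp add: inner_diff_left)
    then have "convergent (\<lambda>n. inner (a n x) x)"
      using a_le a_ge by (intro Bseq_mono_convergent BseqI'[where K = "inner (e x) x"])
        (auto simp: incseq_def)
    then have "Cauchy (\<lambda>n. inner (a n x) x)"
      by (rule convergent_Cauchy)
    then obtain N where N: "\<And>m n. m \<ge> N \<Longrightarrow> n \<ge> N \<Longrightarrow>
        \<bar>inner (a m x) x - inner (a n x) x\<bar> < (r / 2)\<^sup>2 / K"
      using metric_CauchyD[of "\<lambda>n. inner (a n x) x" "(r / 2)\<^sup>2 / K"] r K(1)
      by (auto simp: dist_real_def)
    have near: "dist (a m x) (a N x) < r / 2" if "m \<ge> N" for m
    proof -
      have "(norm (a m x - a N x))\<^sup>2 \<le> K * (inner (a m x) x - inner (a N x) x)"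
        using sq[of "m - N" N x] that by simp
      also have "\<dots> < K * ((r / 2)\<^sup>2 / K)"
        using N[OF that order_refl] by (intro mult_strict_left_mono K) auto
      also have "\<dots> = (r / 2)\<^sup>2"
        using K(1) by simp
      finally show ?thesis
        unfolding dist_norm by (rule power_less_imp_less_base) (use r in simp)
    qed
    have "dist (a m x) (a n x) < r" if "m \<ge> N" "n \<ge> N" for m n
      using dist_triangle_half_l[OF near[OF that(1)] near[OF that(2)]] .
    then show "\<exists>N. \<forall>m\<ge>N. \<forall>n\<ge>N. dist (a m x) (a n x) < r"
      by blast
  qed
  then have "\<exists>z. (\<lambda>n. a n x) \<longlonglongrightarrow> z" for x
    using Cauchy_convergent convergent_def by blast
  then obtain b where b: "\<And>x. (\<lambda>n. a n x) \<longlonglongrightarrow> b x"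
    by metis
  have norm_le: "norm (a n x) \<le> K * norm x" for n x
  proof -
    have form: "inner (a n y) y \<le> K * (norm y)\<^sup>2" for y
      using a_le[of n y] K(3)[of y] by linarith
    have "(norm (a n x))\<^sup>2 \<le> K * inner (a n x) x"
      by (rule pos_op_norm_le[OF a(2) K(1) form])
    also have "\<dots> \<le> K * (K * (norm x)\<^sup>2)"
      by (intro mult_left_mono form) (use K(1) in simp)
    finally have "(norm (a n x))\<^sup>2 \<le> (K * norm x)\<^sup>2"
      by (simp add: power2_eq_square ac_simps)
    then show ?thesis
      by (rule power2_le_imp_le) (use K(1) in simp)
  qed
  have pos_b: "pos_op b"
    by (rule pos_op_lim[OF a(2) b norm_le])
  moreover have "pos_op (\<lambda>x. b x - a n x)" for n
  proof (rule pos_op_lim[OF diff])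
    show "(\<lambda>k. a (k + n) x - a n x) \<longlonglongrightarrow> b x - a n x" for x
      by (intro tendsto_diff tendsto_const LIMSEQ_ignore_initial_segment b)
    show "norm (a (k + n) x - a n x) \<le> (2 * K) * norm x" for k x
      using norm_triangle_ineq4[of "a (k + n) x" "a n x"] norm_le[of "k + n" x] norm_le[of n x]
      by simp
  qed
  moreover have "pos_op (\<lambda>x. e x - b x)"
  proof (rule pos_op_lim[OF le])
    show "(\<lambda>k. e x - a k x) \<longlonglongrightarrow> e x - b x" for x
      by (intro tendsto_diff tendsto_const b)
    show "norm (e x - a k x) \<le> (2 * K) * norm x" for k x
      using norm_triangle_ineq4[of "e x" "a k x"] norm_le[of k x] K(2)[of x] by simp
  qed
  moreover have "b \<in> commutant Q"
  proof (rule commutantI[OF pos_opD(1)[OF pos_b]])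
    fix A x
    assume A: "A \<in> Q"
    have "(\<lambda>n. A (a n x)) \<longlonglongrightarrow> A (b x)"
      by (rule bounded_linear.tendsto[OF bounded_opD(1)[OF Q[OF A]] b])
    moreover have "A (a n x) = a n (A x)" for n
      using commutant_commute[OF a(1) A] by simp
    ultimately show "b (A x) = A (b x)"
      using b[of "A x"] by (simp add: LIMSEQ_unique)
  qed
  ultimately show thesis
    using that b by blast
qed

text \<open>Greedily removing from \<open>e\<close> parts on which \<open>inner (c v) v - \<phi> c\<close> is nearly as negative as
  possible leaves an \<open>h\<close> below which this difference is nonnegative. No normality of \<open>\<phi>\<close> is needed:
  positivity of \<open>\<phi>\<close> suffices to compare it with the limit.\<close>

lemma dominated_interval:
  assumes Q: "\<And>A. A \<in> Q \<Longrightarrow> bounded_op A" and e: "e \<in> commutant Q" "pos_op e"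
    and add: "\<And>a b. a \<in> commutant Q \<Longrightarrow> b \<in> commutant Q \<Longrightarrow> \<phi> (\<lambda>x. a x + b x) = \<phi> a + \<phi> b"
    and pos: "\<And>a. a \<in> commutant Q \<Longrightarrow> pos_op a \<Longrightarrow> 0 \<le> \<phi> a"
    and less: "\<phi> e < inner (e v) v"
  obtains h where "h \<in> commutant Q" "pos_op h" "pos_op (\<lambda>x. e x - h x)" "h \<noteq> (\<lambda>x. 0)"
    "\<And>c. c \<in> commutant Q \<Longrightarrow> pos_op c \<Longrightarrow> pos_op (\<lambda>x. h x - c x) \<Longrightarrow> \<phi> c \<le> inner (c v) v"
proof -
  let ?M = "commutant Q"
  have diff_M: "(\<lambda>x. a x - b x) \<in> ?M" if "a \<in> ?M" "b \<in> ?M" for a b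
    using commutant_add[OF Q that(1) commutant_scale[OF Q that(2), of "complex_of_real (- 1)"]]
    unfolding scaleC_of_real by simp
  have add_M: "(\<lambda>x. a x + b x) \<in> ?M" if "a \<in> ?M" "b \<in> ?M" for a b
    using commutant_add[OF Q that] .
  have zero_M: "(\<lambda>x. 0) \<in> ?M"
    using diff_M[OF id_in_commutant id_in_commutant] by simp
  have phi_diff: "\<phi> (\<lambda>x. a x - b x) = \<phi> a - \<phi> b" if "a \<in> ?M" "b \<in> ?M" for a b
    using add[OF diff_M[OF that] that(2)] by simp
  have phi_zero: "\<phi> (\<lambda>x. 0) = 0"
    using phi_diff[OF e(1) e(1)] by simp
  \<comment> \<open>\<open>P a\<close> says that \<open>a\<close> may already have been removed from
    \<open>e\<close>, and \<open>I a\<close> collects the pieces that may be removed next.\<close>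
  define P where "P a \<longleftrightarrow> a \<in> ?M \<and> pos_op a \<and> pos_op (\<lambda>x. e x - a x)" for a
  define I where "I a = {c \<in> ?M. pos_op c \<and> pos_op (\<lambda>x. e x - a x - c x)}" for a
  define \<psi> where "\<psi> c = inner (c v) v - \<phi> c" for c
  have psi_ge: "- \<phi> e \<le> \<psi> a" if "P a" for a
  proof -
    have "0 \<le> \<phi> e - \<phi> a"
      using pos[of "\<lambda>x. e x - a x"] that e(1) by (simp add: P_def diff_M phi_diff)
    moreover have "0 \<le> inner (a v) v"
      using that pos_opD(3) unfolding P_def by blast
    ultimately show ?thesis
      unfolding \<psi>_def by linarith
  qed
  have P_add: "P (\<lambda>x. a x + c x)" if "P a" "c \<in> I a" for a c
    using that by (simp add: P_def I_def add_M pos_op_add diff_diff_eq)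
  have I_P: "P c" if "P a" "c \<in> I a" for a c
    using that pos_op_add[of "\<lambda>x. e x - a x - c x" a] by (simp add: P_def I_def algebra_simps)
  have zero_I: "(\<lambda>x. 0) \<in> I a" if "P a" for a
    using that by (simp add: I_def P_def zero_M pos_op_zero)
  have psi_zero: "\<psi> (\<lambda>x. 0) = 0"
    by (simp add: \<psi>_def phi_zero)
  \<comment> \<open>The infimum of \<psi> need not be attained, whence the factor 2: a negative
    infimum is undercut by half of it, and otherwise the zero operator serves.\<close>
  have "\<exists>c\<in>I a. \<forall>c'\<in>I a. 2 * \<psi> c \<le> \<psi> c'" if a: "P a" for a
  proof -
    define i where "i = Inf (\<psi> ` I a)"
    have ne: "\<psi> ` I a \<noteq> {}"
      using zero_I[OF a] by blast
    have "bdd_below (\<psi> ` I a)"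
      using psi_ge I_P[OF a] by (auto intro!: bdd_belowI[where m = "- \<phi> e"])
    then have i_le: "i \<le> \<psi> c" if "c \<in> I a" for c
      unfolding i_def using that by (intro cInf_lower) auto
    show ?thesis
    proof (cases "i < 0")
      case True
      then obtain c where c: "c \<in> I a" "\<psi> c < i / 2"
        using cInf_lessD[OF ne, of "i / 2"] unfolding i_def by auto
      have "2 * \<psi> c \<le> \<psi> c'" if "c' \<in> I a" for c'
        using i_le[OF that] c(2) by linarith
      then show ?thesis
        using c(1) by blast
    next
      case False
      have "2 * \<psi> (\<lambda>x. 0) \<le> \<psi> c'" if "c' \<in> I a" for c'
        using i_le[OF that] False psi_zero by linarith
      then show ?thesis
        using zero_I[OF a] by blast
    qed
  qed
  then have "\<exists>c. P a \<longrightarrow> c \<in> I a \<and> (\<forall>c'\<in>I a. 2 * \<psi> c \<le> \<psi> c')" for a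
    by blast
  then obtain ch where ch: "\<And>a. P a \<Longrightarrow> ch a \<in> I a" "\<And>a c'. P a \<Longrightarrow> c' \<in> I a \<Longrightarrow> 2 * \<psi> (ch a) \<le> \<psi> c'"
    by metis
  define a where "a = rec_nat (\<lambda>x. 0) (\<lambda>_ b x. b x + ch b x)"
  have a0: "a 0 = (\<lambda>x. 0)" and aSuc: "a (Suc n) = (\<lambda>x. a n x + ch (a n) x)" for n
    by (simp_all add: a_def)
  have Pa: "P (a n)" for n
  proof (induction n)
    case 0
    then show ?case
      by (simp add: a0 P_def zero_M pos_op_zero e)
  next
    case (Suc n)
    then show ?case
      using P_add ch(1) by (simp add: aSuc)
  qed
  have c_M: "ch (a n) \<in> ?M" and c_pos: "pos_op (ch (a n))" for n
    using ch(1)[OF Pa] by (auto simp: I_def)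
  have psi_Suc: "\<psi> (a (Suc n)) = \<psi> (a n) + \<psi> (ch (a n))" for n
    using Pa[of n] c_M[of n] by (simp add: aSuc \<psi>_def add P_def inner_add_left)
  have psi_c: "\<psi> (ch (a n)) \<le> 0" for n
    using ch(2)[OF Pa zero_I[OF Pa], of n] psi_zero by simp
  have psi_a: "\<psi> (a n) = (\<Sum>k<n. \<psi> (ch (a k)))" for n
    by (induction n) (simp_all add: a0 psi_zero psi_Suc)
  \<comment> \<open>The total \<psi> of the removed pieces is bounded below by
    \<open>- \<phi> e\<close>, so the individual gains tend to 0.\<close>
  have "summable (\<lambda>n. - \<psi> (ch (a n)))"
  proof (rule summableI_nonneg_bounded)
    show "(\<Sum>k<n. - \<psi> (ch (a k))) \<le> \<phi> e" for n
      using psi_ge[OF Pa, of n] by (simp add: psi_a sum_negf)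
  qed (use psi_c in simp)
  then have "(\<lambda>n. - \<psi> (ch (a n))) \<longlonglongrightarrow> 0"
    by (rule summable_LIMSEQ_zero)
  then have c_lim: "(\<lambda>n. 2 * \<psi> (ch (a n))) \<longlonglongrightarrow> 0"
    using tendsto_mult_right_zero[of "\<lambda>n. - \<psi> (ch (a n))" sequentially "- 2"] by simp
  obtain b where b: "b \<in> ?M" "pos_op b" "\<And>n. pos_op (\<lambda>x. b x - a n x)"
    "pos_op (\<lambda>x. e x - b x)" "\<And>x. (\<lambda>n. a n x) \<longlonglongrightarrow> b x"
  proof (rule pos_op_monotone_limit[OF Q, where a = a and e = e])
    show "a n \<in> ?M" "pos_op (a n)" "pos_op (\<lambda>x. e x - a n x)" for n
      using Pa by (auto simp: P_def)
    show "pos_op (\<lambda>x. a (Suc n) x - a n x)" for n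
      by (simp add: aSuc c_pos)
    show "bounded_op e"
      by (rule pos_opD(1)[OF e(2)])
  qed (assumption, rule that)
  define h where "h = (\<lambda>x. e x - b x)"
  have phi_a: "\<phi> (a n) \<le> \<phi> b" for n
    using pos[OF _ b(3), of n] Pa[of n] b(1) by (simp add: P_def diff_M phi_diff)
  have a_phi: "inner (a n v) v \<le> \<phi> b" for n
  proof -
    have "\<psi> (a n) \<le> 0"
      unfolding psi_a by (intro sum_nonpos psi_c)
    then show ?thesis
      using phi_a[of n] by (simp add: \<psi>_def)
  qed
  have "(\<lambda>n. inner (a n v) v) \<longlonglongrightarrow> inner (b v) v"
    by (intro tendsto_inner b(5) tendsto_const)
  then have b_phi: "inner (b v) v \<le> \<phi> b"
    by (rule LIMSEQ_le_const2) (use a_phi in blast)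
  show thesis
  proof (rule that[of h])
    show "h \<in> ?M" "pos_op h" "pos_op (\<lambda>x. e x - h x)"
      using diff_M[OF e(1) b(1)] b by (simp_all add: h_def)
    show "h \<noteq> (\<lambda>x. 0)"
    proof
      assume "h = (\<lambda>x. 0)"
      then have "e x = b x" for x
        unfolding h_def by (simp add: fun_eq_iff)
      then have "e = b" ..
      then show False
        using less b_phi by simp
    qed
    fix c
    assume c: "c \<in> ?M" "pos_op c" "pos_op (\<lambda>x. h x - c x)"
    \<comment> \<open>A piece below the remainder \<open>h\<close> was a candidate at every stage,
      so \<open>\<psi> c\<close> is at least twice each gain.\<close>
    have "c \<in> I (a n)" for n
    proof -
      have "(\<lambda>x. e x - a n x - c x) = (\<lambda>x. (h x - c x) + (b x - a n x))"
        by (simp add: h_def algebra_simps)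
      then show ?thesis
        using pos_op_add[OF c(3) b(3)[of n]] c(1,2) by (simp add: I_def)
    qed
    then have "2 * \<psi> (ch (a n)) \<le> \<psi> c" for n
      using ch(2)[OF Pa] by blast
    then have "0 \<le> \<psi> c"
      by (intro LIMSEQ_le_const2[OF c_lim]) blast
    then show "\<phi> c \<le> inner (c v) v"
      by (simp add: \<psi>_def)
  qed
qed

text \<open>The operator \<open>c = b + \<epsilon>\<close> is symmetric and bounded below by
  \<epsilon>, hence injective; surjectivity comes from Riesz. Its inverse commutes with
  \<open>Q\<close> because \<open>c\<close> does. That the inverse stays in the algebra is what lets
  an isomorphism transport it.\<close>

lemma pos_op_invertible:
  assumes Q: "\<And>A. A \<in> Q \<Longrightarrow> bounded_op A" and b: "b \<in> commutant Q" "pos_op b" and \<epsilon>: "\<epsilon> > 0"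
  obtains r where "r \<in> commutant Q" "\<And>x. r (b x + \<epsilon> *\<^sub>R x) = x"
proof -
  define c where "c x = b x + \<epsilon> *\<^sub>R x" for x
  have c_op: "bounded_op c"
    using bounded_op_add[OF pos_opD(1)[OF b(2)] bounded_op_scaleR[OF bounded_op_id, of \<epsilon>]]
    by (simp add: c_def[abs_def])
  note c_lin = bounded_opD[OF c_op]
  have c_sym: "inner (c x) y = inner x (c y)" for x y
    using pos_opD(2)[OF b(2), of x y] by (simp add: c_def inner_add_left inner_add_right)
  have lower: "\<epsilon> * norm x \<le> norm (c x)" for x
  proof (cases "x = 0")
    case False
    have "(\<epsilon> * norm x) * norm x \<le> inner (c x) x"
      using pos_opD(3)[OF b(2), of x]
      by (simp add: c_def inner_add_left power2_norm_eq_inner[symmetric] power2_eq_square)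
    also have "\<dots> \<le> norm (c x) * norm x"
      by (rule norm_cauchy_schwarz)
    finally show ?thesis
      using False by simp
  qed (use \<epsilon> in simp)
  have inj: "x = y" if "c x = c y" for x y
  proof -
    have "\<epsilon> * norm (x - y) \<le> 0"
      using lower[of "x - y"] that by (simp add: c_lin(3))
    then show ?thesis
      using \<epsilon> by (simp add: mult_le_0_iff)
  qed
  have "\<exists>x. c x = y" for y
  proof -
    \<comment> \<open>The functional sends \<open>c q\<close> to \<open>inner y q\<close>. Its Riesz
      vector \<open>x\<close> satisfies \<open>inner x (c z) = inner y z\<close>, which by symmetry
      of \<open>c\<close> means \<open>c x = y\<close>; the range of \<open>c\<close> need not be
      known to be closed for this.\<close>
    define f where "f w = inner y (inv c w)" for w
    have inv_c: "inv c (c x) = x" for x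
      by (intro inv_f_f injI) (rule inj)
    have "\<exists>x\<in>closure (range c). \<forall>w\<in>range c. inner x w = f w"
    proof (rule riesz_on_subspace[where C = "norm y / \<epsilon>"])
      show "subspace (range c)"
        using linear_subspace_image[OF bounded_linear.linear[OF c_lin(1)] subspace_UNIV] .
      show "f (v + w) = f v + f w" if vw: "v \<in> range c" "w \<in> range c" for v w
      proof -
        obtain p q where pq: "v = c p" "w = c q"
          using vw by (elim rangeE) (rule that)
        show ?thesis
          unfolding pq f_def c_lin(2)[symmetric] inv_c by (rule inner_add_right)
      qed
      show "f (r *\<^sub>R w) = r * f w" if w: "w \<in> range c" for r w
      proof -
        obtain q where q: "w = c q"
          using w by (elim rangeE) (rule that)
        show ?thesis
          unfolding q f_def c_lin(4)[symmetric] inv_c by (rule inner_scaleR_right)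
      qed
      show "\<bar>f w\<bar> \<le> norm y / \<epsilon> * norm w" if w: "w \<in> range c" for w
      proof -
        obtain q where q: "w = c q"
          using w by (elim rangeE) (rule that)
        have "\<bar>f w\<bar> \<le> norm y * norm q"
          unfolding q f_def inv_c by (rule Cauchy_Schwarz_ineq2)
        also have "\<dots> \<le> norm y * (norm w / \<epsilon>)"
          using lower[of q] \<epsilon> by (intro mult_left_mono) (simp_all add: q field_simps)
        finally show ?thesis
          by simp
      qed
    qed
    then obtain x where x: "\<And>z. inner x (c z) = inner y z"
      by (auto simp: f_def inv_c)
    have "c x = y"
      by (rule iffD1[OF vector_eq_rdot]) (simp add: c_sym x)
    then show ?thesis ..
  qed
  then obtain r where cr: "\<And>y. c (r y) = y"
    by metis
  have rc: "r (c x) = x" for x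
    by (rule inj) (rule cr)
  have "bounded_op r"
    unfolding bounded_op_def
  proof (intro conjI allI bounded_linear_intro[where K = "1 / \<epsilon>"])
    show "r (x + y) = r x + r y" for x y
      by (rule inj) (simp only: cr c_lin(2))
    show "r (s *\<^sub>R x) = s *\<^sub>R r x" for s x
      by (rule inj) (simp only: cr c_lin(4))
    show "r (s *\<^sub>C x) = s *\<^sub>C r x" for s x
      by (rule inj) (simp only: cr c_lin(5))
    show "norm (r x) \<le> norm x * (1 / \<epsilon>)" for x
      using lower[of "r x"] \<epsilon> by (simp add: cr field_simps)
  qed
  then have "r \<in> commutant Q"
  proof (rule commutantI)
    fix A x
    assume A: "A \<in> Q"
    have "c (A y) = A (c y)" for y
      using commutant_commute[OF b(1) A, of y] bounded_opD(2,4)[OF Q[OF A]] by (simp add: c_def)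
    then have "c (r (A x)) = c (A (r x))"
      by (simp only: cr)
    then show "r (A x) = A (r x)"
      by (rule inj)
  qed
  then show thesis
    by (rule that) (use rc in \<open>simp add: c_def\<close>)
qed

text \<open>The infimum \<open>m\<close> of the numerical range of \<open>A\<close> is an approximate eigenvalue, by
  \<open>pos_op_norm_le\<close> for \<open>A - m\<close>.\<close>

lemma pos_opI_bounded_below:
  assumes A: "bounded_op A" "\<And>x y. inner (A x) y = inner x (A y)"
    and below: "\<And>\<epsilon>. \<epsilon> > 0 \<Longrightarrow> \<exists>B. \<forall>x. norm x \<le> B * norm (A x + \<epsilon> *\<^sub>R x)"
  shows "pos_op A"
proof (rule ccontr)
  assume "\<not> pos_op A"
  then obtain x0 where x0: "inner (A x0) x0 < 0"
    using A by (auto simp: pos_op_def not_le)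
  define S where "S = (\<lambda>x. inner (A x) x) ` sphere 0 1"
  define m where "m = Inf S"
  note lin = bounded_opD[OF A(1)]
  obtain K where K: "K > 0" "\<And>x. norm (A x) \<le> K * norm x" "\<And>x. inner (A x) x \<le> K * (norm x)\<^sup>2"
    by (rule bounded_op_bound[OF A(1)]) (rule that)
  have "- K \<le> inner (A x) x" if "norm x = 1" for x
    using Cauchy_Schwarz_ineq2[of "A x" x] K(2)[of x] that by simp
  then have bdd: "bdd_below S"
    by (auto simp: S_def intro!: bdd_belowI[where m = "- K"])
  define u where "u = (1 / norm x0) *\<^sub>R x0"
  have "x0 \<noteq> 0"
    using x0 lin(6) by auto
  then have "norm u = 1"
    by (simp add: u_def)
  then have u_S: "inner (A u) u \<in> S"
    by (auto simp: S_def)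
  have "inner (A u) u < 0"
    using x0 \<open>x0 \<noteq> 0\<close> by (simp add: u_def lin(4) zero_less_mult_iff mult_less_0_iff divide_less_0_iff)
  then have "m < 0"
    using cInf_lower[OF u_S bdd] unfolding m_def by linarith
  have form_ge: "m * (norm x)\<^sup>2 \<le> inner (A x) x" for x
  proof (cases "x = 0")
    case False
    have "(1 / norm x) *\<^sub>R x \<in> sphere 0 1"
      using False by simp
    then have "m \<le> inner (A ((1 / norm x) *\<^sub>R x)) ((1 / norm x) *\<^sub>R x)"
      unfolding m_def S_def by (intro cInf_lower bdd[unfolded S_def] imageI)
    also have "\<dots> = inner (A x) x / (norm x)\<^sup>2"
      by (simp add: lin(4) power2_eq_square)
    finally show ?thesis
      using False by (simp add: field_simps)
  qed (simp add: lin(6))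
  define C where "C x = A x + (- m) *\<^sub>R x" for x
  have C_form: "inner (C x) x = inner (A x) x - m * (norm x)\<^sup>2" for x
    by (simp add: C_def inner_add_left power2_norm_eq_inner inner_diff_left)
  have "bounded_op C"
    using bounded_op_add[OF A(1) bounded_op_scaleR[OF bounded_op_id, of "- m"]]
    by (simp add: C_def[abs_def])
  moreover have "inner (C x) y = inner x (C y)" for x y
    using A(2)[of x y] by (simp add: C_def inner_add_left inner_add_right inner_diff_left inner_diff_right)
  moreover have "0 \<le> inner (C x) x" for x
    using form_ge[of x] by (simp add: C_form)
  ultimately have pos_C: "pos_op C"
    unfolding pos_op_def by blast
  have C_le: "inner (C x) x \<le> (K - m) * (norm x)\<^sup>2" for x
    using K(3)[of x] by (simp add: C_form algebra_simps)
  obtain B where B: "\<And>x. norm x \<le> B * norm (C x)"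
    using below[of "- m"] \<open>m < 0\<close> unfolding C_def by auto
  \<comment> \<open>A lower bound for \<open>C = A - m\<close> keeps the numerical range of
    \<open>A\<close> at distance at least \<open>1 / (B\<^sup>2 * (K - m))\<close> from its own
    infimum \<open>m\<close>.\<close>
  have gap: "1 \<le> B\<^sup>2 * (K - m) * (inner (A x) x - m)" if x: "norm x = 1" for x
  proof -
    have "1 = (norm x)\<^sup>2"
      by (simp add: x)
    also have "\<dots> \<le> (B * norm (C x))\<^sup>2"
      by (intro power_mono B) simp
    also have "\<dots> = B\<^sup>2 * (norm (C x))\<^sup>2"
      by (simp add: power_mult_distrib)
    also have "\<dots> \<le> B\<^sup>2 * ((K - m) * inner (C x) x)"
      by (intro mult_left_mono pos_op_norm_le[OF pos_C _ C_le]) (use K(1) \<open>m < 0\<close> in simp_all)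
    finally show ?thesis
      using x by (simp add: C_form)
  qed
  define D where "D = B\<^sup>2 * (K - m)"
  have "D > 0"
  proof -
    have "0 \<le> D" "D \<noteq> 0"
      using gap[OF \<open>norm u = 1\<close>] K(1) \<open>m < 0\<close> by (auto simp: D_def)
    then show ?thesis
      by simp
  qed
  then obtain s where "s \<in> S" "s < m + 1 / D"
    using cInf_lessD[of S "m + 1 / D"] u_S unfolding m_def by fastforce
  then obtain x where x: "norm x = 1" "inner (A x) x < m + 1 / D"
    by (auto simp: S_def)
  then have "D * (inner (A x) x - m) < D * (1 / D)"
    using \<open>D > 0\<close> by (intro mult_strict_left_mono) auto
  then show False
    using gap[OF x(1)] \<open>D > 0\<close> unfolding D_def[symmetric] by simp
qed

text \<open>The vector \<open>P x\<close> represents \<open>inner x\<close> on \<open>W\<close>. In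
  the last clause both sides lie in \<open>W\<close>, and moving \<open>T\<close> across the inner
  product uses invariance under its adjoint; this clause places projections onto reducing subspaces
  in commutants.\<close>

lemma projection_exists:
  fixes W :: "'h::chilbert_space set"
  assumes W: "subspace W" "closed W" "\<And>c x. x \<in> W \<Longrightarrow> c *\<^sub>C x \<in> W"
  obtains P where "bounded_op P" "\<And>x. P x \<in> W" "\<And>x y. inner (P x) y = inner x (P y)"
    "\<And>x. x \<in> W \<Longrightarrow> P x = x"
    "\<And>T x. bounded_op T \<Longrightarrow> \<forall>y\<in>W. T y \<in> W \<and> cadjoint T y \<in> W \<Longrightarrow> P (T x) = T (P x)"
proof -
  have clos: "closure W = W"
    using W(2) by simp
  have "\<exists>p\<in>closure W. \<forall>w\<in>W. inner p w = inner x w" for x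
    by (rule riesz_on_subspace[OF W(1), where C = "norm x"])
      (simp_all add: inner_add_right Cauchy_Schwarz_ineq2)
  then obtain P where P: "\<And>x. P x \<in> W" "\<And>x w. w \<in> W \<Longrightarrow> inner (P x) w = inner x w"
    unfolding clos by metis
  have eqI: "P x = p" if "p \<in> W" "\<And>w. w \<in> W \<Longrightarrow> inner x w = inner p w" for x p
    by (rule closure_eqI_inner[OF W(1)]) (use that P in \<open>simp_all add: clos\<close>)
  show thesis
  proof (rule that[of P])
    show "bounded_op P"
      unfolding bounded_op_def
    proof (intro conjI allI bounded_linear_intro[where K = 1])
      show "P (x + y) = P x + P y" for x y
        by (rule eqI) (simp_all add: P subspace_add[OF W(1)] inner_add_left)
      show "P (r *\<^sub>R x) = r *\<^sub>R P x" for r x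
        by (rule eqI) (simp_all add: P subspace_scale[OF W(1)])
      show "P (c *\<^sub>C x) = c *\<^sub>C P x" for c x
      proof (rule eqI)
        fix w
        assume "w \<in> W"
        have "inner (c *\<^sub>C z) w = inner z (cnj c *\<^sub>C w)" for z
          by (simp add: inner_scaleC_right)
        then show "inner (c *\<^sub>C x) w = inner (c *\<^sub>C P x) w"
          using P(2)[OF W(3)[OF \<open>w \<in> W\<close>]] by simp
      qed (intro W P)
      show "norm (P x) \<le> norm x * 1" for x
      proof (cases "P x = 0")
        case False
        have "norm (P x) * norm (P x) = inner x (P x)"
          using P(2)[OF P(1), of x x] by (simp add: power2_norm_eq_inner flip: power2_eq_square)
        also have "\<dots> \<le> norm x * norm (P x)"
          by (rule norm_cauchy_schwarz)
        finally show ?thesis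
          using False by simp
      qed simp
    qed
    show "P x \<in> W" for x
      by (rule P)
    show "inner (P x) y = inner x (P y)" for x y
      using P(2)[OF P(1), of x y] P(2)[OF P(1), of y x] inner_commute[of "P y" "P x"]
        inner_commute[of "P x" y] by linarith
    show "P x = x" if "x \<in> W" for x
      by (rule eqI[OF that refl])
    show "P (T x) = T (P x)" if T: "bounded_op T" "\<forall>y\<in>W. T y \<in> W \<and> cadjoint T y \<in> W" for T x
    proof (rule eqI)
      show "inner (T x) w = inner (T (P x)) w" if "w \<in> W" for w
        using T(2) that by (simp add: inner_cadjoint[OF T(1)] P(2))
    qed (use T(2) P(1) in blast)
  qed
qed

section \<open>Isomorphisms of von Neumann algebras\<close>

text \<open>Von Neumann algebras appear without topology, as adjoint-closed sets equal to their
  bicommutants. Their algebraic closure properties then follow from those of commutants.\<close>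

locale vn_isomorphism =
  fixes M :: "('h::chilbert_space \<Rightarrow> 'h) set" and N :: "('k::chilbert_space \<Rightarrow> 'k) set" and \<tau>
  assumes M_bicommutant: "bicommutant M = M" and N_bicommutant: "bicommutant N = N"
    and M_cadjoint: "A \<in> M \<Longrightarrow> cadjoint A \<in> M" and N_cadjoint: "B \<in> N \<Longrightarrow> cadjoint B \<in> N"
    and iso: "op_star_isomorphism M N \<tau>"
begin

lemma M_bounded: "A \<in> M \<Longrightarrow> bounded_op A"
  using M_bicommutant commutant_bounded by blast

lemma N_bounded: "B \<in> N \<Longrightarrow> bounded_op B"
  using N_bicommutant commutant_bounded by blast

lemma M_id: "id \<in> M"
  using M_bicommutant id_in_commutant by metis

lemma N_id: "id \<in> N"
  using N_bicommutant id_in_commutant by metis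

lemma M_comp: "A \<in> M \<Longrightarrow> B \<in> M \<Longrightarrow> A \<circ> B \<in> M"
  using M_bicommutant commutant_comp by metis

lemma M_add: "A \<in> M \<Longrightarrow> B \<in> M \<Longrightarrow> (\<lambda>x. A x + B x) \<in> M"
  using commutant_add[of "commutant M" A B] M_bicommutant commutant_bounded by auto

lemma M_scale: "A \<in> M \<Longrightarrow> (\<lambda>x. c *\<^sub>C A x) \<in> M"
  using commutant_scale[of "commutant M" A c] M_bicommutant commutant_bounded by auto

lemma M_scaleR: "A \<in> M \<Longrightarrow> (\<lambda>x. r *\<^sub>R A x) \<in> M"
  using M_scale[of A "complex_of_real r"] by (simp only: scaleC_of_real)

lemma M_zero: "(\<lambda>x. 0) \<in> M"
  using M_scale[OF M_id, of 0] by simp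

lemma tau_bij: "bij_betw \<tau> M N"
  and tau_add: "A \<in> M \<Longrightarrow> B \<in> M \<Longrightarrow> \<tau> (\<lambda>x. A x + B x) = (\<lambda>x. \<tau> A x + \<tau> B x)"
  and tau_scale: "A \<in> M \<Longrightarrow> \<tau> (\<lambda>x. c *\<^sub>C A x) = (\<lambda>x. c *\<^sub>C \<tau> A x)"
  and tau_comp: "A \<in> M \<Longrightarrow> B \<in> M \<Longrightarrow> \<tau> (A \<circ> B) = \<tau> A \<circ> \<tau> B"
  and tau_cadjoint: "A \<in> M \<Longrightarrow> \<tau> (cadjoint A) = cadjoint (\<tau> A)"
  using iso by (simp_all add: op_star_isomorphism_def)

lemma tau_scaleR: "A \<in> M \<Longrightarrow> \<tau> (\<lambda>x. r *\<^sub>R A x) = (\<lambda>x. r *\<^sub>R \<tau> A x)"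
  using tau_scale[of A "complex_of_real r"] by (simp only: scaleC_of_real)

lemma tau_in: "A \<in> M \<Longrightarrow> \<tau> A \<in> N"
  using tau_bij by (auto simp: bij_betw_def)

lemma tau_eqD: "\<tau> A = \<tau> B \<Longrightarrow> A \<in> M \<Longrightarrow> B \<in> M \<Longrightarrow> A = B"
  using tau_bij unfolding bij_betw_def by (auto dest: inj_onD)

lemma tau_surj:
  assumes "B \<in> N"
  obtains A where "A \<in> M" "\<tau> A = B"
proof -
  have "B \<in> \<tau> ` M"
    using tau_bij assms by (simp add: bij_betw_def)
  then show thesis
    using that by blast
qed

text \<open>An \<open>op_star_isomorphism\<close> is not defined to be unital; the preimage of
  \<open>id\<close> provides this.\<close>

lemma tau_id: "\<tau> id = id"
proof -
  obtain A where A: "A \<in> M" "\<tau> A = id"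
    by (rule tau_surj[OF N_id])
  show ?thesis
    using tau_comp[OF M_id A(1)] A(2) by simp
qed

lemma tau_zero: "\<tau> (\<lambda>x. 0) = (\<lambda>x. 0)"
  using tau_scale[OF M_id, of 0] by simp

lemma tau_symmetric:
  assumes A: "A \<in> M" "\<And>x y. inner (A x) y = inner x (A y)"
  shows "inner (\<tau> A x) y = inner x (\<tau> A y)"
proof -
  have "cadjoint A = A"
    by (rule cadjoint_eqI) (rule M_bounded[OF A(1)], rule A(2))
  then show ?thesis
    using inner_cadjoint[OF N_bounded[OF tau_in[OF A(1)]], of x y] tau_cadjoint[OF A(1)] by simp
qed

text \<open>Positivity is transported through invertibility instead of square roots: \<tau> carries
  the inverse of \<open>A + \<epsilon>\<close> to a bounded left inverse of
  \<open>\<tau> A + \<epsilon>\<close>, so the latter is bounded below for every positive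
  \<epsilon>.\<close>

lemma tau_pos:
  assumes A: "A \<in> M" "pos_op A"
  shows "pos_op (\<tau> A)"
proof (rule pos_opI_bounded_below)
  show "bounded_op (\<tau> A)"
    by (intro N_bounded tau_in A)
  show "inner (\<tau> A x) y = inner x (\<tau> A y)" for x y
    by (rule tau_symmetric[OF A(1) pos_opD(2)[OF A(2)]])
  fix \<epsilon> :: real
  assume "\<epsilon> > 0"
  obtain r where r: "r \<in> M" "\<And>x. r (A x + \<epsilon> *\<^sub>R x) = x"
    by (rule pos_op_invertible[where Q = "commutant M", unfolded M_bicommutant, OF _ A \<open>\<epsilon> > 0\<close>])
      (rule commutant_bounded, assumption, rule that)
  define c where "c = (\<lambda>x. A x + \<epsilon> *\<^sub>R id x)"
  have c: "c \<in> M"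
    unfolding c_def by (intro M_add M_scaleR M_id A)
  have "r \<circ> c = id"
    by (simp add: fun_eq_iff c_def r(2))
  then have "\<tau> r \<circ> \<tau> c = id"
    using tau_comp[OF r(1) c] tau_id by simp
  moreover have "\<tau> c = (\<lambda>x. \<tau> A x + \<epsilon> *\<^sub>R x)"
    unfolding c_def tau_add[OF A(1) M_scaleR[OF M_id]] tau_scaleR[OF M_id] tau_id by simp
  ultimately have inverse: "\<tau> r (\<tau> A x + \<epsilon> *\<^sub>R x) = x" for x
    by (simp add: fun_eq_iff)
  obtain B where B: "\<And>x. norm (\<tau> r x) \<le> B * norm x"
    by (rule bounded_op_bound[OF N_bounded[OF tau_in[OF r(1)]]]) (rule that)
  have "norm x \<le> B * norm (\<tau> A x + \<epsilon> *\<^sub>R x)" for x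
    using B[of "\<tau> A x + \<epsilon> *\<^sub>R x"] by (simp only: inverse)
  then show "\<exists>B. \<forall>x. norm x \<le> B * norm (\<tau> A x + \<epsilon> *\<^sub>R x)"
    by blast
qed

section \<open>Intertwiners from the space of \<open>N\<close> to the space of \<open>M\<close>, and
  their separation property\<close>

definition intertwiner :: "('k \<Rightarrow> 'h) \<Rightarrow> bool" where
  "intertwiner L \<longleftrightarrow> bounded_linear L \<and> (\<forall>c x. L (c *\<^sub>C x) = c *\<^sub>C L x) \<and>
     (\<forall>b\<in>M. \<forall>x. L (\<tau> b x) = b (L x))"

text \<open>By \<open>dom\<close> the map \<open>b v \<mapsto> \<tau> b z\<close> is a contraction
  on the orbit of \<open>v\<close> under \<open>M\<close>, and \<open>L\<close> is its adjoint:
  \<open>L k\<close> is the Riesz vector of the pairing with \<open>k\<close>. It intertwines since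
  \<open>M\<close> is closed under adjoints.\<close>

lemma intertwiner_exists:
  assumes dom: "\<And>b. b \<in> M \<Longrightarrow> norm (\<tau> b z) \<le> norm (b v)"
  obtains L where "intertwiner L" "\<And>b k. b \<in> M \<Longrightarrow> inner (L k) (b v) = inner k (\<tau> b z)"
proof -
  define W where "W = (\<lambda>b. b v) ` M"
  define g where "g w = \<tau> (SOME b. b \<in> M \<and> b v = w) z" for w
  have g: "g (b v) = \<tau> b z" if b: "b \<in> M" for b
  proof -
    define b' where "b' = (SOME a. a \<in> M \<and> a v = b v)"
    have b': "b' \<in> M" "b' v = b v"
      using someI[of "\<lambda>a. a \<in> M \<and> a v = b v" b] b unfolding b'_def by auto
    \<comment> \<open>The bound \<open>dom\<close> for the difference \<open>b' - b\<close>, which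
      kills \<open>v\<close>, shows that \<open>g\<close> does not depend on the choice of
      \<open>b\<close>.\<close>
    have "norm (\<tau> (\<lambda>x. b' x + (- 1) *\<^sub>R b x) z) \<le> norm (b' v + (- 1) *\<^sub>R b v)"
      by (rule dom) (intro M_add M_scaleR b b')
    then have "norm (\<tau> b' z - \<tau> b z) \<le> 0"
      unfolding tau_add[OF b'(1) M_scaleR[OF b]] tau_scaleR[OF b] b'(2) by simp
    then show ?thesis
      by (simp add: g_def b'_def)
  qed
  have W: "subspace W"
  proof (rule subspaceI)
    show "0 \<in> W"
      using M_zero by (force simp: W_def)
    show "x + y \<in> W" if "x \<in> W" "y \<in> W" for x y
    proof -
      obtain a b where ab: "a \<in> M" "b \<in> M" "x = a v" "y = b v"
        using \<open>x \<in> W\<close> \<open>y \<in> W\<close> by (auto simp: W_def)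
      show ?thesis
        unfolding W_def ab(3,4) by (rule image_eqI[OF _ M_add[OF ab(1,2)]]) simp
    qed
    show "r *\<^sub>R x \<in> W" if "x \<in> W" for r x
    proof -
      obtain a where a: "a \<in> M" "x = a v"
        using \<open>x \<in> W\<close> by (auto simp: W_def)
      show ?thesis
        unfolding W_def a(2) by (rule image_eqI[OF _ M_scaleR[OF a(1), of r]]) simp
    qed
  qed
  have "\<exists>y\<in>closure W. \<forall>w\<in>W. inner y w = inner k (g w)" for k
  proof (rule riesz_on_subspace[OF W, where C = "norm k"])
    fix x y
    assume "x \<in> W" "y \<in> W"
    then obtain a b where ab: "a \<in> M" "b \<in> M" "x = a v" "y = b v"
      by (auto simp: W_def)
    have "g (x + y) = g x + g y"
      using g[OF M_add[OF ab(1,2)]] g[OF ab(1)] g[OF ab(2)] tau_add[OF ab(1,2)] by (simp add: ab)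
    then show "inner k (g (x + y)) = inner k (g x) + inner k (g y)"
      by (simp add: inner_add_right)
  next
    fix r x
    assume "x \<in> W"
    then obtain a where a: "a \<in> M" "x = a v"
      by (auto simp: W_def)
    have "g (r *\<^sub>R x) = r *\<^sub>R g x"
      using g[OF M_scaleR[OF a(1)], of r] g[OF a(1)] tau_scaleR[OF a(1)] by (simp add: a)
    then show "inner k (g (r *\<^sub>R x)) = r * inner k (g x)"
      by simp
  next
    fix x
    assume "x \<in> W"
    then obtain a where a: "a \<in> M" "x = a v"
      by (auto simp: W_def)
    have "\<bar>inner k (g x)\<bar> \<le> norm k * norm (g x)"
      by (rule Cauchy_Schwarz_ineq2)
    also have "\<dots> \<le> norm k * norm x"
      unfolding a(2) g[OF a(1)] by (intro mult_left_mono dom a) simp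
    finally show "\<bar>inner k (g x)\<bar> \<le> norm k * norm x" .
  qed
  then obtain L where L: "\<And>k. L k \<in> closure W" "\<And>k w. w \<in> W \<Longrightarrow> inner (L k) w = inner k (g w)"
    by metis
  have Lb: "inner (L k) (b v) = inner k (\<tau> b z)" if "b \<in> M" for k b
    using L(2)[of "b v" k] g that by (simp add: W_def)
  have L_eqI: "L k = y" if y: "y \<in> closure W" "\<And>b. b \<in> M \<Longrightarrow> inner k (\<tau> b z) = inner y (b v)"
    for k y
    by (rule closure_eqI_inner[OF W L(1) y(1)]) (auto simp: W_def Lb y(2))
  have closW: "subspace (closure W)"
    by (rule closure_subspace[OF W])
  have b_W: "b x \<in> closure W" if b: "b \<in> M" and x: "x \<in> closure W" for b x
  proof -
    have "b ` closure W \<subseteq> closure W"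
    proof (rule image_closure_subset)
      show "continuous_on (closure W) b"
        by (rule linear_continuous_on) (rule bounded_opD(1)[OF M_bounded[OF b]])
      have "b ` W \<subseteq> W"
      proof
        fix w
        assume "w \<in> b ` W"
        then obtain a where "a \<in> M" "w = (b \<circ> a) v"
          by (auto simp: W_def)
        then show "w \<in> W"
          unfolding W_def using M_comp[OF b] by blast
      qed
      then show "b ` W \<subseteq> closure W"
        using closure_subset by blast
    qed simp
    then show ?thesis
      using x by blast
  qed
  have L_add: "L (x + y) = L x + L y" for x y
    by (rule L_eqI) (simp_all add: subspace_add[OF closW] L(1) inner_add_left Lb)
  have L_scaleR: "L (r *\<^sub>R x) = r *\<^sub>R L x" for r x
    by (rule L_eqI) (simp_all add: subspace_scale[OF closW] L(1) Lb)
  have L_tau: "L (\<tau> b x) = b (L x)" if b: "b \<in> M" for b x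
  proof (rule L_eqI)
    show "b (L x) \<in> closure W"
      by (rule b_W[OF b L(1)])
    fix a
    assume a: "a \<in> M"
    have "inner (\<tau> b x) (\<tau> a z) = inner x (cadjoint (\<tau> b) (\<tau> a z))"
      by (rule inner_cadjoint[OF N_bounded[OF tau_in[OF b]]])
    also have "\<dots> = inner x (\<tau> (cadjoint b \<circ> a) z)"
      by (simp add: tau_comp[OF M_cadjoint[OF b] a] tau_cadjoint[OF b])
    also have "\<dots> = inner (L x) ((cadjoint b \<circ> a) v)"
      by (rule Lb[symmetric]) (rule M_comp[OF M_cadjoint[OF b] a])
    also have "\<dots> = inner (b (L x)) (a v)"
      by (simp add: inner_cadjoint[OF M_bounded[OF b]])
    finally show "inner (\<tau> b x) (\<tau> a z) = inner (b (L x)) (a v)" .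
  qed
  \<comment> \<open>Scalar multiples of \<open>id\<close> belong to \<open>M\<close>, so complex
    homogeneity is a case of intertwining.\<close>
  have L_scaleC: "L (c *\<^sub>C x) = c *\<^sub>C L x" for c x
    using L_tau[OF M_scale[OF M_id, of c], of x] unfolding tau_scale[OF M_id] tau_id by simp
  have "norm (L k) \<le> norm k * 1" for k
  proof (cases "L k = 0")
    case False
    have "closure W \<subseteq> {w. inner (L k) w \<le> norm k * norm w}"
    proof (rule closure_minimal)
      show "W \<subseteq> {w. inner (L k) w \<le> norm k * norm w}"
      proof
        fix w
        assume "w \<in> W"
        then obtain a where a: "a \<in> M" "w = a v"
          by (auto simp: W_def)
        have "inner (L k) w \<le> norm k * norm (\<tau> a z)"
          unfolding a(2) Lb[OF a(1)] by (rule norm_cauchy_schwarz)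
        also have "\<dots> \<le> norm k * norm w"
          unfolding a(2) by (intro mult_left_mono dom a) simp
        finally show "w \<in> {w. inner (L k) w \<le> norm k * norm w}"
          by simp
      qed
    qed (intro closed_Collect_le continuous_intros)
    then have "inner (L k) (L k) \<le> norm k * norm (L k)"
      using L(1) by blast
    then show ?thesis
      using False by (simp add: power2_norm_eq_inner[symmetric] power2_eq_square)
  qed simp
  then have "bounded_linear L"
    by (intro bounded_linear_intro[where K = 1] L_add L_scaleR)
  then have "intertwiner L"
    unfolding intertwiner_def using L_scaleC L_tau by blast
  then show thesis
    by (rule that) (rule Lb)
qed

text \<open>With \<open>q = \<tau> e\<close> the projection onto the closure of \<open>commutant N\<close> applied to \<open>y\<close>, the functional
  \<open>a \<mapsto> \<langle>\<tau> a y, y\<rangle>\<close> is dominated below some nonzero \<open>h \<le> e\<close> by a vector functional of \<open>M\<close>, which yields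
  an intertwiner not vanishing at \<open>\<tau> h y\<close>.\<close>

lemma intertwiners_separate:
  assumes kill: "\<And>L. intertwiner L \<Longrightarrow> L y = 0"
  shows "y = 0"
proof (rule ccontr)
  assume "y \<noteq> 0"
  let ?N' = "commutant N"
  define W0 where "W0 = (\<lambda>T. T y) ` ?N'"
  define W where "W = closure W0"
  have W0: "subspace W0"
  proof (rule subspaceI)
    show "0 \<in> W0"
      unfolding W0_def
      by (rule image_eqI[OF _ commutant_scale[OF N_bounded id_in_commutant, where c = 0]]) simp
    show "a + b \<in> W0" if "a \<in> W0" "b \<in> W0" for a b
    proof -
      obtain S T where ST: "S \<in> ?N'" "T \<in> ?N'" "a = S y" "b = T y"
        using \<open>a \<in> W0\<close> \<open>b \<in> W0\<close> by (auto simp: W0_def)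
      show ?thesis
        unfolding W0_def ST(3,4) by (rule image_eqI[OF _ commutant_add[OF N_bounded ST(1,2)]]) simp
    qed
    show "r *\<^sub>R a \<in> W0" if "a \<in> W0" for r a
    proof -
      obtain S where S: "S \<in> ?N'" "a = S y"
        using \<open>a \<in> W0\<close> by (auto simp: W0_def)
      show ?thesis
        unfolding W0_def S(2)
        by (rule image_eqI[OF _ commutant_scale[OF N_bounded S(1), where c = "complex_of_real r"]])
          (simp_all only: scaleC_of_real)
    qed
  qed
  have N'_W: "T w \<in> W" if T: "T \<in> ?N'" and w: "w \<in> W" for T w
  proof -
    have "T ` closure W0 \<subseteq> closure W0"
    proof (rule image_closure_subset)
      show "continuous_on (closure W0) T"
        by (rule linear_continuous_on) (rule bounded_opD(1)[OF commutant_bounded[OF T]])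
      have "T ` W0 \<subseteq> W0"
      proof
        fix u
        assume "u \<in> T ` W0"
        then obtain S where "S \<in> ?N'" "u = (T \<circ> S) y"
          by (auto simp: W0_def)
        then show "u \<in> W0"
          unfolding W0_def using commutant_comp[OF T] by blast
      qed
      then show "T ` W0 \<subseteq> closure W0"
        using closure_subset by blast
    qed simp
    then show ?thesis
      using w unfolding W_def by blast
  qed
  have "y \<in> W0"
    unfolding W0_def by (rule image_eqI[OF _ id_in_commutant]) simp
  then have y_W: "y \<in> W"
    unfolding W_def using closure_subset by blast
  have scaleC_W: "c *\<^sub>C w \<in> W" if "w \<in> W" for c w
    using N'_W[OF commutant_scale[OF N_bounded id_in_commutant, where c = c] that] by simp
  have sub_W: "subspace W" "closed W"
    unfolding W_def by (rule closure_subspace[OF W0]) simp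
  obtain q where q: "bounded_op q" "\<And>x. q x \<in> W" "\<And>x y. inner (q x) y = inner x (q y)"
    "\<And>x. x \<in> W \<Longrightarrow> q x = x"
    "\<And>T x. bounded_op T \<Longrightarrow> \<forall>y\<in>W. T y \<in> W \<and> cadjoint T y \<in> W \<Longrightarrow> q (T x) = T (q x)"
    by (rule projection_exists[OF sub_W scaleC_W]) (assumption, rule that)
  \<comment> \<open>The subspace \<open>W\<close> is invariant under \<open>commutant N\<close>,
    which is closed under adjoints; so \<open>q\<close> lies in the bicommutant of
    \<open>N\<close>.\<close>
  have "q \<in> commutant ?N'"
  proof (rule commutantI[OF q(1)])
    fix T x
    assume T: "T \<in> ?N'"
    show "q (T x) = T (q x)"
      using N'_W[OF T] N'_W[OF commutant_cadjoint[OF N_bounded N_cadjoint T]]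
      by (intro q(5) commutant_bounded[OF T]) blast
  qed
  then have "q \<in> N"
    by (simp only: N_bicommutant)
  then obtain e where e: "e \<in> M" "\<tau> e = q"
    by (rule tau_surj)
  have qq: "q \<circ> q = q"
    using q(2,4) by (simp add: fun_eq_iff)
  have "e \<circ> e = e"
    by (rule tau_eqD[OF _ M_comp[OF e(1) e(1)] e(1)]) (simp add: tau_comp e qq)
  then have ee: "e (e x) = e x" for x
    by (simp add: fun_eq_iff)
  have "cadjoint q = q"
    by (rule cadjoint_eqI[OF q(1,3)])
  then have "cadjoint e = e"
    by (intro tau_eqD[OF _ M_cadjoint[OF e(1)] e(1)]) (simp only: tau_cadjoint[OF e(1)] e(2))
  then have e_sym: "inner (e x) y = inner x (e y)" for x y
    using inner_cadjoint[OF M_bounded[OF e(1)], of x y] by simp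
  have e_pos: "pos_op e"
  proof -
    have "0 \<le> inner (e x) x" for x
      using e_sym[of "e x" x] by (simp add: ee)
    then show ?thesis
      unfolding pos_op_def using M_bounded[OF e(1)] e_sym by blast
  qed
  have "e \<noteq> (\<lambda>x. 0)"
  proof
    assume "e = (\<lambda>x. 0)"
    then have "q y = 0"
      using e(2) tau_zero by auto
    then show False
      using q(4)[OF y_W] \<open>y \<noteq> 0\<close> by simp
  qed
  then obtain x0 where x0: "e x0 \<noteq> 0"
    by blast
  note e_lin = bounded_opD[OF M_bounded[OF e(1)]]
  \<comment> \<open>The length \<open>norm y + 1\<close> makes \<open>inner (e v) v\<close> exceed
    \<open>\<phi> e = (norm y)\<^sup>2\<close>, as \<open>dominated_interval\<close>
    requires.\<close>
  define v where "v = ((norm y + 1) / norm (e x0)) *\<^sub>R e x0"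
  have ev: "e v = v"
    by (simp add: v_def e_lin(4) ee)
  have norm_v: "norm v = norm y + 1"
    using x0 by (simp add: v_def)
  define \<phi> where "\<phi> a = inner (\<tau> a y) y" for a
  have less: "\<phi> e < inner (e v) v"
  proof -
    have "(norm y)\<^sup>2 < (norm y + 1)\<^sup>2"
      by (intro power_strict_mono) auto
    then show ?thesis
      unfolding \<phi>_def e(2) q(4)[OF y_W] ev power2_norm_eq_inner[symmetric] norm_v .
  qed
  obtain h where h: "h \<in> M" "pos_op h" "pos_op (\<lambda>x. e x - h x)" "h \<noteq> (\<lambda>x. 0)"
    "\<And>c. c \<in> M \<Longrightarrow> pos_op c \<Longrightarrow> pos_op (\<lambda>x. h x - c x) \<Longrightarrow> \<phi> c \<le> inner (c v) v"
  proof (rule dominated_interval[where Q = "commutant M" and e = e and \<phi> = \<phi> and v = v,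
        unfolded M_bicommutant])
    show "\<phi> (\<lambda>x. a x + b x) = \<phi> a + \<phi> b" if "a \<in> M" "b \<in> M" for a b
      by (simp add: \<phi>_def tau_add[OF that] inner_add_left)
    show "0 \<le> \<phi> a" if "a \<in> M" "pos_op a" for a
      unfolding \<phi>_def by (rule pos_opD(3)[OF tau_pos[OF that]])
  qed (rule commutant_bounded, assumption, rule e, rule e_pos, rule less, rule that)
  obtain H where H: "H > 0" "\<And>x. norm (h x) \<le> H * norm x" "\<And>x. inner (h x) x \<le> H * (norm x)\<^sup>2"
    by (rule bounded_op_bound[OF M_bounded[OF h(1)]]) (rule that)
  have h_sym: "inner (h x) y = inner x (h y)" for x y
    by (rule pos_opD(2)[OF h(2)])
  have tau_h_sym: "inner (\<tau> h x) y = inner x (\<tau> h y)" for x y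
    by (rule tau_symmetric[OF h(1) h_sym])
  have h_le: "(norm (h x))\<^sup>2 \<le> H * inner (h x) x" for x
    by (rule pos_op_norm_le[OF h(2) H(1) H(3)])
  \<comment> \<open>The vectors are \<open>h v\<close> and \<open>\<tau> h y\<close> because \<phi>
    is dominated only below \<open>h\<close>. The squared norms are the two forms at
    \<open>g\<close>, which is \<open>cadjoint c \<circ> c\<close> sandwiched between copies of
    \<open>h\<close>, and a positive multiple of \<open>g\<close> lies below
    \<open>h\<close>.\<close>
  have dom: "norm (\<tau> c (\<tau> h y)) \<le> norm (c (h v))" if c: "c \<in> M" for c
  proof -
    obtain K where K: "K > 0" "\<And>x. norm (c x) \<le> K * norm x" "\<And>x. inner (c x) x \<le> K * (norm x)\<^sup>2"
      by (rule bounded_op_bound[OF M_bounded[OF c]]) (rule that)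
    define g where "g = h \<circ> (cadjoint c \<circ> (c \<circ> h))"
    have g: "g \<in> M"
      unfolding g_def by (intro M_comp h(1) c M_cadjoint)
    have g_form: "inner (g x) y = inner (c (h x)) (c (h y))" for x y
      using inner_cadjoint[OF bounded_op_cadjoint[OF M_bounded[OF c]], of "c (h x)" "h y"]
      by (simp add: g_def h_sym cadjoint_cadjoint[OF M_bounded[OF c]])
    have g_sym: "inner (g x) y = inner x (g y)" for x y
      using g_form[of x y] g_form[of y x] inner_commute[of "c (h x)" "c (h y)"] inner_commute[of x "g y"]
      by linarith
    \<comment> \<open>The factor \<open>K\<^sup>2\<close> bounds \<open>c\<close>, and
      \<open>H\<close> comes from \<open>h_le\<close>; together they put \<open>t\<close> times
      \<open>g\<close> below \<open>h\<close>.\<close>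
    define t where "t = 1 / (K\<^sup>2 * H)"
    have "t > 0"
      using K(1) H(1) by (simp add: t_def)
    have tg_le: "t * (norm (c (h x)))\<^sup>2 \<le> inner (h x) x" for x
    proof -
      have "(norm (c (h x)))\<^sup>2 \<le> (K * norm (h x))\<^sup>2"
        by (intro power_mono K) simp
      also have "\<dots> = K\<^sup>2 * (norm (h x))\<^sup>2"
        by (rule power_mult_distrib)
      also have "\<dots> \<le> K\<^sup>2 * (H * inner (h x) x)"
        by (intro mult_left_mono h_le) simp
      finally show ?thesis
        using K(1) H(1) by (simp add: t_def field_simps)
    qed
    have "pos_op (\<lambda>x. t *\<^sub>R g x)"
      unfolding pos_op_def
    proof (intro conjI allI)
      show "inner (t *\<^sub>R g x) y = inner x (t *\<^sub>R g y)" for x y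
        using g_sym[of x y] by simp
      show "0 \<le> inner (t *\<^sub>R g x) x" for x
        using \<open>t > 0\<close> by (simp add: g_form)
    qed (intro bounded_op_scaleR M_bounded g)
    moreover have "pos_op (\<lambda>x. h x - t *\<^sub>R g x)"
      unfolding pos_op_def
    proof (intro conjI allI)
      show "inner (h x - t *\<^sub>R g x) y = inner x (h y - t *\<^sub>R g y)" for x y
        using g_sym[of x y] h_sym[of x y] by (simp add: inner_diff_left inner_diff_right)
      show "0 \<le> inner (h x - t *\<^sub>R g x) x" for x
        using tg_le[of x] by (simp add: inner_diff_left g_form power2_norm_eq_inner)
    qed (intro bounded_op_diff bounded_op_scaleR M_bounded g h)
    ultimately have "\<phi> (\<lambda>x. t *\<^sub>R g x) \<le> inner (t *\<^sub>R g v) v"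
      by (intro h(5) M_scaleR g)
    then have "t * inner (\<tau> g y) y \<le> t * inner (g v) v"
      unfolding \<phi>_def tau_scaleR[OF g] by simp
    then have "inner (\<tau> g y) y \<le> inner (g v) v"
      using \<open>t > 0\<close> by simp
    moreover have "inner (g v) v = (norm (c (h v)))\<^sup>2"
      unfolding g_form power2_norm_eq_inner ..
    moreover have "inner (\<tau> g y) y = (norm (\<tau> c (\<tau> h y)))\<^sup>2"
    proof -
      have tau_c: "bounded_op (\<tau> c)"
        by (intro N_bounded tau_in c)
      have "\<tau> g = \<tau> h \<circ> (cadjoint (\<tau> c) \<circ> (\<tau> c \<circ> \<tau> h))"
        unfolding g_def by (simp only: tau_comp M_comp h(1) c M_cadjoint tau_cadjoint)
      then have "inner (\<tau> g y) y = inner (cadjoint (\<tau> c) (\<tau> c (\<tau> h y))) (\<tau> h y)"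
        by (simp add: tau_h_sym)
      also have "\<dots> = inner (\<tau> c (\<tau> h y)) (\<tau> c (\<tau> h y))"
        using inner_cadjoint[OF bounded_op_cadjoint[OF tau_c], of "\<tau> c (\<tau> h y)" "\<tau> h y"]
        by (simp only: cadjoint_cadjoint[OF tau_c])
      finally show ?thesis
        by (simp only: power2_norm_eq_inner)
    qed
    ultimately show ?thesis
      by (simp add: power2_le_iff_abs_le)
  qed
  obtain L where L: "intertwiner L"
    "\<And>b k. b \<in> M \<Longrightarrow> inner (L k) (b (h v)) = inner k (\<tau> b (\<tau> h y))"
    by (rule intertwiner_exists[OF dom]) (assumption, rule that)
  have "L (\<tau> h y) = h (L y)"
    using L(1) h(1) by (simp add: intertwiner_def)
  then have "L (\<tau> h y) = 0"
    using kill[OF L(1)] bounded_opD(6)[OF M_bounded[OF h(1)]] by simp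
  \<comment> \<open>For \<open>b = id\<close> and \<open>k = \<tau> h y\<close> the relation
    defining \<open>L\<close> has left side 0 and right side the squared norm of
    \<open>\<tau> h y\<close>.\<close>
  then have hy: "\<tau> h y = 0"
    using L(2)[OF M_id, of "\<tau> h y"] by (simp add: tau_id)
  have "W \<subseteq> {w. \<tau> h w = 0}"
    unfolding W_def
  proof (rule closure_minimal)
    show "closed {w. \<tau> h w = 0}"
      by (intro closed_Collect_eq linear_continuous_on continuous_on_const bounded_opD(1) N_bounded
          tau_in h(1))
    show "W0 \<subseteq> {w. \<tau> h w = 0}"
    proof
      fix w
      assume "w \<in> W0"
      then obtain T where T: "T \<in> ?N'" "w = T y"
        by (auto simp: W0_def)
      have "\<tau> h w = T (\<tau> h y)"
        using commutant_commute[OF T(1) tau_in[OF h(1)], of y] T(2) by simp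
      then show "w \<in> {w. \<tau> h w = 0}"
        using hy bounded_opD(6)[OF commutant_bounded[OF T(1)]] by simp
    qed
  qed
  then have "\<tau> h \<circ> q = (\<lambda>x. 0)"
    using q(2) by (auto simp: fun_eq_iff)
  then have "h \<circ> e = (\<lambda>x. 0)"
    by (intro tau_eqD[OF _ M_comp[OF h(1) e(1)] M_zero]) (simp only: tau_comp[OF h(1) e(1)] e(2) tau_zero)
  then have he: "h (e x) = 0" for x
    by (simp add: fun_eq_iff)
  \<comment> \<open>On the range of \<open>e\<close> this is \<open>he\<close>; on the complement it
    holds because \<open>h\<close> is positive and below \<open>e\<close>.\<close>
  have "h x = 0" for x
  proof -
    define u where "u = x - e x"
    have "e u = 0"
      by (simp add: u_def e_lin(3) ee)
    then have "inner (h u) u \<le> 0"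
      using pos_opD(3)[OF h(3), of u] by (simp add: inner_diff_left)
    then have "(norm (h u))\<^sup>2 \<le> 0"
      using h_le[of u] H(1) by (meson mult_nonneg_nonpos order.trans less_imp_le)
    then have "h u = 0"
      by simp
    then show ?thesis
      using he[of x] by (simp add: u_def bounded_opD(3)[OF M_bounded[OF h(1)]])
  qed
  then show False
    using h(4) by blast
qed

text \<open>Let \<open>X\<close> be the commutator of \<open>T\<close> with \<open>\<tau> x\<close>
  and \<open>V\<close> the adjoint of \<open>L1\<close>. Separation is used twice. Each
  \<open>L2 T V\<close> commutes with \<open>x\<close>, so every \<open>L2\<close> kills the values
  of \<open>X V\<close>, whence \<open>X V = 0\<close>. Passing to adjoints, every \<open>L1\<close>
  kills the values of the adjoint of \<open>X\<close>, so that operator vanishes, and with it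
  \<open>X\<close>.\<close>

lemma tau_in_bicommutant:
  assumes P: "P \<subseteq> M" and x: "x \<in> bicommutant P"
  shows "\<tau> x \<in> bicommutant (\<tau> ` P)"
proof (rule commutantI)
  have "bicommutant P \<subseteq> bicommutant M"
    by (intro commutant_antimono P)
  then have xM: "x \<in> M"
    using x M_bicommutant by blast
  note tau_x = N_bounded[OF tau_in[OF xM]]
  show "bounded_op (\<tau> x)"
    by (rule tau_x)
  fix T k
  assume T: "T \<in> commutant (\<tau> ` P)"
  note T_op = commutant_bounded[OF T]
  define X where "X = (\<lambda>k. (T \<circ> \<tau> x) k - (\<tau> x \<circ> T) k)"
  have X: "bounded_op X"
    unfolding X_def by (intro bounded_op_diff bounded_op_comp T_op tau_x)
  have "L1 (cadjoint X k) = 0" if L1: "intertwiner L1" for L1 k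
  proof -
    have L1_lin: "bounded_linear L1" and L1_scaleC: "\<And>c x. L1 (c *\<^sub>C x) = c *\<^sub>C L1 x"
      and L1_tau: "\<And>b x. b \<in> M \<Longrightarrow> L1 (\<tau> b x) = b (L1 x)"
      using L1 by (auto simp: intertwiner_def)
    obtain V where V: "bounded_linear V" "\<And>x y. inner (L1 x) y = inner x (V y)"
      by (rule adjoint_exists[OF L1_lin]) (rule that)
    have V_scaleC: "V (c *\<^sub>C x) = c *\<^sub>C V x" for c x
      by (rule adjoint_scaleC[OF L1_scaleC V(2)])
    \<comment> \<open>The adjoint of an intertwiner intertwines in the opposite direction, since
      \<open>M\<close> is closed under adjoints.\<close>
    have V_tau: "V (b y) = \<tau> b (V y)" if b: "b \<in> M" for b y
    proof (rule iffD1[OF vector_eq_ldot], intro allI)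
      fix k
      have "inner k (V (b y)) = inner (cadjoint b (L1 k)) y"
        using inner_cadjoint[OF bounded_op_cadjoint[OF M_bounded[OF b]], of "L1 k" y]
        by (simp add: V(2)[symmetric] cadjoint_cadjoint[OF M_bounded[OF b]])
      also have "\<dots> = inner (\<tau> (cadjoint b) k) (V y)"
        by (simp only: L1_tau[OF M_cadjoint[OF b], symmetric] V(2))
      also have "\<dots> = inner k (\<tau> b (V y))"
        using inner_cadjoint[OF bounded_op_cadjoint[OF N_bounded[OF tau_in[OF b]]], of k "V y"]
        by (simp only: tau_cadjoint[OF b] cadjoint_cadjoint[OF N_bounded[OF tau_in[OF b]]])
      finally show "inner k (V (b y)) = inner k (\<tau> b (V y))" .
    qed
    have XV: "X (V y) = 0" for y
    proof (rule intertwiners_separate)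
      fix L2
      assume L2: "intertwiner L2"
      then have L2_lin: "bounded_linear L2" and L2_scaleC: "\<And>c x. L2 (c *\<^sub>C x) = c *\<^sub>C L2 x"
        and L2_tau: "\<And>b x. b \<in> M \<Longrightarrow> L2 (\<tau> b x) = b (L2 x)"
        by (auto simp: intertwiner_def)
      define S where "S = (\<lambda>x. L2 (T (V x)))"
      have "S \<in> commutant P"
      proof (rule commutantI)
        show "bounded_op S"
          unfolding bounded_op_def S_def using bounded_opD(1,5)[OF T_op]
          by (simp add: V_scaleC L2_scaleC bounded_linear_compose[OF L2_lin]
              bounded_linear_compose[OF bounded_opD(1)[OF T_op] V(1)])
        show "S (A y) = A (S y)" if A: "A \<in> P" for A y
        proof -
          have AM: "A \<in> M"
            using A P by blast
          have "T (\<tau> A (V y)) = \<tau> A (T (V y))"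
            by (rule commutant_commute[OF T imageI[OF A]])
          then show ?thesis
            by (simp add: S_def V_tau[OF AM] L2_tau[OF AM])
        qed
      qed
      then have "x (S y) = S (x y)"
        by (rule commutant_commute[OF x])
      then have "L2 (\<tau> x (T (V y))) = L2 (T (\<tau> x (V y)))"
        by (simp only: S_def V_tau[OF xM] L2_tau[OF xM])
      then show "L2 (X (V y)) = 0"
        using linear_diff[OF bounded_linear.linear[OF L2_lin]] by (simp add: X_def)
    qed
    have "inner (L1 (cadjoint X k)) y = 0" for y
      using inner_cadjoint[OF X, of "V y" k] V(2)[of "cadjoint X k" y] XV[of y]
        inner_commute[of "V y" "cadjoint X k"] by simp
    then show ?thesis
      using inner_eq_zero_iff by blast
  qed
  then have "cadjoint X k' = 0" for k'
    using intertwiners_separate by blast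
  then have "inner (X k) (X k) = 0"
    using inner_cadjoint[OF X, of k "X k"] by simp
  then have "X k = 0"
    by simp
  then show "\<tau> x (T k) = T (\<tau> x k)"
    by (simp add: X_def)
qed

lemma vn_isomorphism_inverse: "vn_isomorphism N M (the_inv_into M \<tau>)"
proof -
  define \<sigma> where "\<sigma> = the_inv_into M \<tau>"
  have inj: "inj_on \<tau> M" and img: "\<tau> ` M = N"
    using tau_bij by (auto simp: bij_betw_def)
  have \<sigma>: "\<sigma> B \<in> M" "\<tau> (\<sigma> B) = B" if "B \<in> N" for B
    using that the_inv_into_into[OF inj, of B M] f_the_inv_into_f[OF inj, of B] img
    by (auto simp: \<sigma>_def)
  have eqI: "\<sigma> B = A" if "A \<in> M" "\<tau> A = B" for A B
    unfolding \<sigma>_def by (rule the_inv_into_f_eq[OF inj]) (use that in auto)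
  have "op_star_isomorphism N M \<sigma>"
    unfolding op_star_isomorphism_def
  proof (intro conjI ballI allI)
    show "bij_betw \<sigma> N M"
      unfolding \<sigma>_def by (rule bij_betw_the_inv_into[OF tau_bij])
    fix A
    assume A: "A \<in> N"
    show "\<sigma> (\<lambda>x. c *\<^sub>C A x) = (\<lambda>x. c *\<^sub>C \<sigma> A x)" for c
      by (rule eqI) (simp_all add: M_scale \<sigma> A tau_scale)
    show "\<sigma> (cadjoint A) = cadjoint (\<sigma> A)"
      by (rule eqI) (simp_all add: M_cadjoint \<sigma> A tau_cadjoint)
    fix B
    assume B: "B \<in> N"
    show "\<sigma> (\<lambda>x. A x + B x) = (\<lambda>x. \<sigma> A x + \<sigma> B x)"
      by (rule eqI) (simp_all add: M_add \<sigma> A B tau_add)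
    show "\<sigma> (A \<circ> B) = \<sigma> A \<circ> \<sigma> B"
      by (rule eqI) (simp_all add: M_comp \<sigma> A B tau_comp)
  qed
  then show ?thesis
    unfolding \<sigma>_def
    by (intro vn_isomorphism.intro M_bicommutant N_bicommutant M_cadjoint N_cadjoint)
qed

end

text \<open>The second inclusion is the first one for the inverse isomorphism and the image of
  \<open>P\<close>.\<close>

theorem (in vn_isomorphism) tau_bicommutant:
  assumes P: "P \<subseteq> M"
  shows "\<tau> ` bicommutant P = bicommutant (\<tau> ` P)"
proof
  show "\<tau> ` bicommutant P \<subseteq> bicommutant (\<tau> ` P)"
    using tau_in_bicommutant[OF P] by blast
  interpret inv: vn_isomorphism N M "the_inv_into M \<tau>"
    by (rule vn_isomorphism_inverse)
  have inj: "inj_on \<tau> M"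
    using tau_bij by (simp add: bij_betw_def)
  show "bicommutant (\<tau> ` P) \<subseteq> \<tau> ` bicommutant P"
  proof
    fix y
    assume y: "y \<in> bicommutant (\<tau> ` P)"
    have sub: "\<tau> ` P \<subseteq> N"
      using P tau_in by blast
    then have "bicommutant (\<tau> ` P) \<subseteq> bicommutant N"
      by (intro commutant_antimono)
    then have "y \<in> N"
      using y N_bicommutant by blast
    have "the_inv_into M \<tau> ` \<tau> ` P = P"
      using the_inv_into_f_f[OF inj] P by (force simp: image_image)
    then have "the_inv_into M \<tau> y \<in> bicommutant P"
      using inv.tau_in_bicommutant[OF sub y] by simp
    moreover have "\<tau> (the_inv_into M \<tau> y) = y"
      using \<open>y \<in> N\<close> tau_bij by (intro f_the_inv_into_f[OF inj]) (simp add: bij_betw_def)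
    ultimately show "y \<in> \<tau> ` bicommutant P"
      by force
  qed
qed

section \<open>Automatic continuity of *-automorphisms\<close>

lemma norm_adj: "norm (adj a) = norm (a :: 'a::cstar_algebra)"
proof -
  have le: "norm b \<le> norm (adj b)" for b :: 'a
  proof (cases "b = 0")
    case False
    have "norm b * norm b \<le> norm (adj b) * norm b"
      using norm_mult_ineq[of "adj b" b] by (simp add: cstar_identity power2_eq_square)
    then show ?thesis
      using False by simp
  qed simp
  show ?thesis
    using le[of a] le[of "adj a"] by (simp add: adj_adj)
qed

lemma adj_scaleR: "adj (r *\<^sub>R a) = r *\<^sub>R adj (a :: 'a::cstar_algebra)"
  using adj_scaleC[of "complex_of_real r" a] by (simp only: scaleC_of_real complex_cnj_complex_of_real)

lemma bounded_linear_adj: "bounded_linear (adj :: 'a::cstar_algebra \<Rightarrow> 'a)"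
  by (rule bounded_linear_intro[where K = 1]) (simp_all add: adj_add adj_scaleR norm_adj)

lemma adj_one: "adj 1 = (1 :: 'a::cstar_algebra)"
  using adj_mult[of "adj 1" "1 :: 'a"] by (simp add: adj_adj)

lemma adj_power: "adj (a ^ n) = adj (a :: 'a::cstar_algebra) ^ n"
  by (induction n) (simp_all add: adj_one adj_mult power_commutes)

lemma norm_unitary: "unitary_element u \<Longrightarrow> norm u = 1"
  using cstar_identity[of u] power2_eq_imp_eq[of "norm u" 1] by (simp add: unitary_element_def)

text \<open>The recursion factor \<open>(1/2 - n) / (n + 1)\<close> has modulus at most 1. This
  crude bound is enough to compare the square root series with a geometric series.\<close>

lemma abs_gbinomial_half_le: "\<bar>(1/2 :: real) gchoose n\<bar> \<le> 1"
proof (induction n)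
  case (Suc n)
  have "(1/2 :: real) gchoose Suc n = ((1/2 - real n) / real (Suc n)) * ((1/2) gchoose n)"
    using gbinomial_absorption'[of "Suc n" "1/2 :: real"] gbinomial_mult_1[of "1/2 :: real" n]
    by (simp add: field_simps)
  then have "\<bar>(1/2 :: real) gchoose Suc n\<bar> = \<bar>(1/2 - real n) / real (Suc n)\<bar> * \<bar>(1/2) gchoose n\<bar>"
    by (simp add: abs_mult)
  also have "\<dots> \<le> 1 * 1"
    by (intro mult_mono Suc.IH) (auto simp: field_simps)
  finally show ?case
    by simp
qed simp

text \<open>This is the binomial series of exponent 1/2 in \<open>- a\<close>. By Vandermonde its
  Cauchy square has the coefficients \<open>1 gchoose n\<close>, which vanish from
  \<open>n = 2\<close> on. Self-adjointness and commutation are inherited term by term.\<close>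

lemma selfadjoint_sqrt_exists:
  fixes a :: "'a::cstar_algebra"
  assumes a: "adj a = a" "norm a < 1"
  obtains s where "adj s = s" "s * s = 1 - a" "\<And>b. b * a = a * b \<Longrightarrow> b * s = s * b"
proof -
  define c where "c n = (1/2 :: real) gchoose n" for n
  define f where "f n = c n *\<^sub>R (- a) ^ n" for n
  have norm_f: "norm (f n) \<le> norm a ^ n" for n
  proof -
    have "norm (f n) \<le> 1 * norm (- a) ^ n"
      unfolding f_def norm_scaleR c_def
      by (intro mult_mono abs_gbinomial_half_le norm_power_ineq) auto
    then show ?thesis
      by simp
  qed
  have norm_sums: "summable (\<lambda>n. norm (f n))"
    by (rule summable_comparison_test'[where N = 0, OF summable_geometric[of "norm a"]])
      (use a(2) norm_f in auto)
  define s where "s = suminf f"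
  have s: "f sums s"
    unfolding s_def by (intro summable_sums summable_norm_cancel[OF norm_sums])
  have "adj (f n) = f n" for n
    using a(1) linear_neg[OF bounded_linear.linear[OF bounded_linear_adj], of a]
    by (simp add: f_def adj_scaleR adj_power)
  then have "f sums adj s"
    using bounded_linear.sums[OF bounded_linear_adj s] by simp
  then have "adj s = s"
    by (rule sums_unique2[OF _ s])
  moreover have "s * s = 1 - a"
  proof -
    have "(\<Sum>i\<le>n. f i * f (n - i)) = ((1 :: real) gchoose n) *\<^sub>R (- a) ^ n" for n
    proof -
      have "(\<Sum>i\<le>n. f i * f (n - i)) = (\<Sum>i\<le>n. (c i * c (n - i)) *\<^sub>R (- a) ^ n)"
        by (intro sum.cong refl) (simp add: f_def flip: power_add)
      also have "\<dots> = (\<Sum>i\<le>n. c i * c (n - i)) *\<^sub>R (- a) ^ n"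
        by (simp add: scaleR_sum_left)
      also have "(\<Sum>i\<le>n. c i * c (n - i)) = (1/2 + 1/2 :: real) gchoose n"
        unfolding c_def gbinomial_Vandermonde[symmetric] by (simp add: atLeast0AtMost)
      finally show ?thesis
        by simp
    qed
    then have "(\<lambda>n. ((1 :: real) gchoose n) *\<^sub>R (- a) ^ n) sums (s * s)"
      using Cauchy_product_sums[OF norm_sums norm_sums] by (simp add: s_def)
    moreover have "(\<lambda>n. ((1 :: real) gchoose n) *\<^sub>R (- a) ^ n) sums
        (\<Sum>n\<in>{0, 1}. ((1 :: real) gchoose n) *\<^sub>R (- a) ^ n)"
    proof (rule sums_finite)
      fix n :: nat
      assume "n \<notin> {0, 1}"
      then show "((1 :: real) gchoose n) *\<^sub>R (- a) ^ n = 0"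
        using binomial_gbinomial[of 1 n, where 'a = real] by (simp add: binomial_eq_0)
    qed simp
    ultimately show ?thesis
      using sums_unique2 by fastforce
  qed
  moreover have "b * s = s * b" if b: "b * a = a * b" for b
  proof -
    have "b * (- a) ^ n = (- a) ^ n * b" for n
      by (rule power_commuting_commutes[symmetric]) (simp add: b)
    then have "(\<lambda>n. b * f n) = (\<lambda>n. f n * b)"
      by (simp add: f_def)
    then show ?thesis
      using sums_mult[OF s, of b] sums_mult2[OF s, of b] sums_unique2 by metis
  qed
  ultimately show thesis
    using that by blast
qed

lemma scaleC_i_i: "\<i> *\<^sub>C \<i> *\<^sub>C a = - (a :: 'a::complex_vector)"
  using scaleC_of_real[of "- 1" a] by (simp add: scaleC_scaleC)

text \<open>As in cos + \<i> sin, take \<open>w = h + \<i> *\<^sub>C s\<close> with \<open>s\<close>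
  a square root of \<open>1 - h * h\<close>. The cross terms in the products of \<open>w\<close>
  with its adjoint cancel because \<open>h\<close> and \<open>s\<close> commute.\<close>

lemma selfadjoint_eq_Re_unitary:
  fixes h :: "'a::cstar_algebra"
  assumes h: "adj h = h" "norm h < 1"
  obtains w where "unitary_element w" "h = (1/2) *\<^sub>R (w + adj w)"
proof -
  have "norm (h * h) < 1"
    using cstar_identity[of h] h power_strict_mono[of "norm h" 1 2] by simp
  then obtain s where s: "adj s = s" "s * s = 1 - h * h" "\<And>b. b * (h * h) = h * h * b \<Longrightarrow> b * s = s * b"
    using selfadjoint_sqrt_exists[of "h * h"] h(1) adj_mult by metis
  have hs: "h * s = s * h"
    by (rule s(3)) (simp add: mult.assoc)
  define w where "w = h + \<i> *\<^sub>C s"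
  have minus: "(- c) *\<^sub>C a = - (c *\<^sub>C a)" for c and a :: 'a
    using scaleC_add_left[of "- c" c a] scaleC_of_real[of 0 a] by (simp add: eq_neg_iff_add_eq_0)
  have adj_w: "adj w = h - \<i> *\<^sub>C s"
    by (simp add: w_def adj_add adj_scaleC h s minus)
  have "unitary_element w"
    unfolding unitary_element_def adj_w
    by (simp add: w_def algebra_simps mult_scaleC_left mult_scaleC_right scaleC_add_right
        scaleC_diff_right scaleC_i_i s hs)
  moreover have "h = (1/2) *\<^sub>R (w + adj w)"
    unfolding adj_w by (simp add: w_def flip: scaleR_2)
  ultimately show thesis
    by (rule that)
qed

lemma star_automorphismD:
  assumes "star_automorphism_on S \<alpha>"
  shows "bij_betw \<alpha> S S" "\<And>a b. a \<in> S \<Longrightarrow> b \<in> S \<Longrightarrow> \<alpha> (a + b) = \<alpha> a + \<alpha> b"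
    "\<And>a c. a \<in> S \<Longrightarrow> \<alpha> (c *\<^sub>C a) = c *\<^sub>C \<alpha> a"
    "\<And>a b. a \<in> S \<Longrightarrow> b \<in> S \<Longrightarrow> \<alpha> (a * b) = \<alpha> a * \<alpha> b"
    "\<And>a. a \<in> S \<Longrightarrow> \<alpha> (adj a) = adj (\<alpha> a)"
  using assms by (auto simp: star_automorphism_on_def)

lemma star_automorphism_one:
  assumes \<alpha>: "star_automorphism_on S \<alpha>" and "1 \<in> S"
  shows "\<alpha> 1 = 1"
proof -
  have "1 \<in> \<alpha> ` S"
    using star_automorphismD(1)[OF \<alpha>] \<open>1 \<in> S\<close> by (simp add: bij_betw_def)
  then obtain a where a: "a \<in> S" "\<alpha> a = 1"
    by force
  show ?thesis
    using star_automorphismD(4)[OF \<alpha> \<open>1 \<in> S\<close> a(1)] a(2) by simp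
qed

text \<open>Unitaries go to unitaries, which have norm 1, and a self-adjoint element of norm below 1
  is the mean of a unitary and its adjoint. Scaling and the C*-identity do the rest, so no spectral
  radius is involved.\<close>

lemma norm_star_automorphism_le:
  fixes \<alpha> :: "'a::cstar_algebra \<Rightarrow> 'a"
  assumes \<alpha>: "star_automorphism_on UNIV \<alpha>"
  shows "norm (\<alpha> a) \<le> norm a"
proof -
  note hom = star_automorphismD(2-5)[OF \<alpha>, simplified]
  have scaleR: "\<alpha> (r *\<^sub>R a) = r *\<^sub>R \<alpha> a" for r a
    using hom(2)[of "complex_of_real r" a] by (simp only: scaleC_of_real)
  have one: "\<alpha> 1 = 1"
    by (rule star_automorphism_one[OF \<alpha>]) simp
  have small: "norm (\<alpha> h) \<le> 1" if h: "adj h = h" "norm h < 1" for h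
  proof -
    obtain w where w: "unitary_element w" "h = (1/2) *\<^sub>R (w + adj w)"
      by (rule selfadjoint_eq_Re_unitary[OF h])
    have "unitary_element (\<alpha> w)"
      using w(1) one by (simp add: unitary_element_def flip: hom)
    then have "norm (\<alpha> w) = 1"
      by (rule norm_unitary)
    moreover have "norm (\<alpha> h) \<le> (1/2) * (norm (\<alpha> w) + norm (adj (\<alpha> w)))"
      using norm_triangle_ineq[of "\<alpha> w" "adj (\<alpha> w)"] by (simp add: w(2) scaleR hom)
    ultimately show ?thesis
      by (simp add: norm_adj)
  qed
  have selfadjoint: "norm (\<alpha> h) \<le> norm h" if h: "adj h = h" for h
  proof (rule dense_ge)
    fix r
    assume r: "norm h < r"
    then have "r > 0"
      using norm_ge_zero[of h] by linarith
    have "norm (\<alpha> ((1/r) *\<^sub>R h)) \<le> 1"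
      by (rule small) (use r \<open>r > 0\<close> in \<open>simp_all add: adj_scaleR h\<close>)
    then show "norm (\<alpha> h) \<le> r"
      using \<open>r > 0\<close> by (simp add: scaleR field_simps)
  qed
  have "(norm (\<alpha> a))\<^sup>2 = norm (\<alpha> (adj a * a))"
    by (simp add: hom cstar_identity)
  also have "\<dots> \<le> norm (adj a * a)"
    by (rule selfadjoint) (simp add: adj_mult adj_adj)
  also have "\<dots> = (norm a)\<^sup>2"
    by (rule cstar_identity)
  finally show ?thesis
    by simp
qed

lemma bounded_linear_star_automorphism:
  fixes \<alpha> :: "'a::cstar_algebra \<Rightarrow> 'a"
  assumes \<alpha>: "star_automorphism_on UNIV \<alpha>"
  shows "bounded_linear \<alpha>"
proof (rule bounded_linear_intro[where K = 1])
  show "\<alpha> (r *\<^sub>R a) = r *\<^sub>R \<alpha> a" for r a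
    using star_automorphismD(3)[OF \<alpha> UNIV_I, of "complex_of_real r" a] by (simp only: scaleC_of_real)
qed (use norm_star_automorphism_le[OF \<alpha>] star_automorphismD(2)[OF \<alpha>] in simp_all)

section \<open>Quasi-equivalence\<close>

lemma star_representationD:
  assumes \<pi>: "star_representation \<pi>"
  shows "bounded_op (\<pi> a)" "\<pi> (a * b) = \<pi> a \<circ> \<pi> b" "cadjoint (\<pi> a) = \<pi> (adj a)"
proof -
  show op: "bounded_op (\<pi> a)" and "\<pi> (a * b) = \<pi> a \<circ> \<pi> b"
    using \<pi> by (simp_all add: star_representation_def)
  have "cinner (\<pi> a x) y = cinner x (\<pi> (adj a) y)" for x y
    using \<pi> by (simp add: star_representation_def)
  then show "cadjoint (\<pi> a) = \<pi> (adj a)"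
    by (intro cadjoint_eqI[OF op]) (simp add: inner_eq_Re_cinner)
qed

text \<open>Non-degeneracy enters here: \<open>\<pi> 1\<close> fixes every \<open>\<pi> a x\<close>,
  and these vectors span a dense subspace. It makes the images of unitary elements unitary
  operators.\<close>

lemma star_representation_one:
  assumes \<pi>: "star_representation \<pi>"
  shows "\<pi> 1 = id"
proof -
  note op = bounded_opD[OF star_representationD(1)[OF \<pi>, of 1]]
  have "{\<pi> a x | a x. True} \<subseteq> {y. \<pi> 1 y = y}"
  proof
    fix y
    assume "y \<in> {\<pi> a x | a x. True}"
    then obtain a x where y: "y = \<pi> a x"
      by blast
    show "y \<in> {y. \<pi> 1 y = y}"
      using fun_cong[OF star_representationD(2)[OF \<pi>, of 1 a], of x] by (simp add: y)
  qed
  moreover have "subspace {y. \<pi> 1 y = y}"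
    by (rule subspaceI) (simp_all add: op(2,4,6))
  ultimately have "span {\<pi> a x | a x. True} \<subseteq> {y. \<pi> 1 y = y}"
    by (rule span_minimal)
  moreover have "closed {y. \<pi> 1 y = y}"
    by (intro closed_Collect_eq linear_continuous_on op(1) continuous_on_id)
  ultimately have "closure (span {\<pi> a x | a x. True}) \<subseteq> {y. \<pi> 1 y = y}"
    by (rule closure_minimal)
  then show ?thesis
    using \<pi> by (auto simp: star_representation_def fun_eq_iff)
qed

lemma bicommutant_star_closed:
  assumes \<pi>: "star_representation \<pi>" and R: "\<And>a. a \<in> R \<Longrightarrow> adj a \<in> R" and A: "A \<in> bicommutant (\<pi> ` R)"
  shows "cadjoint A \<in> bicommutant (\<pi> ` R)"
proof (rule commutant_cadjoint[OF commutant_bounded _ A])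
  show "cadjoint T \<in> commutant (\<pi> ` R)" if "T \<in> commutant (\<pi> ` R)" for T
    by (rule commutant_cadjoint[OF _ _ that])
      (use R in \<open>auto simp: star_representationD[OF \<pi>]\<close>)
qed

text \<open>The given \<tau> is restricted to the smaller bicommutant; identifying its image is the
  content of \<open>tau_bicommutant\<close>.\<close>

lemma quasi_equivalent_on_subset:
  fixes \<pi>\<^sub>1 :: "'a::cstar_algebra \<Rightarrow> 'h::chilbert_space \<Rightarrow> 'h" and \<pi>\<^sub>2 :: "'a \<Rightarrow> 'k::chilbert_space \<Rightarrow> 'k"
  assumes \<pi>\<^sub>1: "star_representation \<pi>\<^sub>1" and \<pi>\<^sub>2: "star_representation \<pi>\<^sub>2"
    and R: "\<And>a. a \<in> R \<Longrightarrow> adj a \<in> R" and S: "S \<subseteq> R" and qe: "quasi_equivalent_on R \<pi>\<^sub>1 \<pi>\<^sub>2"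
  shows "quasi_equivalent_on S \<pi>\<^sub>1 \<pi>\<^sub>2"
proof -
  let ?M = "bicommutant (\<pi>\<^sub>1 ` R)" and ?N = "bicommutant (\<pi>\<^sub>2 ` R)"
  have op1: "bounded_op A" if "A \<in> \<pi>\<^sub>1 ` X" for A X
    using that star_representationD(1)[OF \<pi>\<^sub>1] by blast
  have op2: "bounded_op A" if "A \<in> \<pi>\<^sub>2 ` X" for A X
    using that star_representationD(1)[OF \<pi>\<^sub>2] by blast
  obtain \<tau> where \<tau>: "op_star_isomorphism ?M ?N \<tau>" "\<And>a. a \<in> R \<Longrightarrow> \<tau> (\<pi>\<^sub>1 a) = \<pi>\<^sub>2 a"
    using qe by (auto simp: quasi_equivalent_on_def)
  interpret vn_isomorphism ?M ?N \<tau>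
    by (intro vn_isomorphism.intro \<tau>(1) bicommutant_star_closed[OF \<pi>\<^sub>1 R] bicommutant_star_closed[OF \<pi>\<^sub>2 R])
      (simp_all only: commutant_bicommutant[OF op1] commutant_bicommutant[OF op2])
  have P: "\<pi>\<^sub>1 ` S \<subseteq> ?M"
    using S subset_bicommutant[OF op1[of _ R]] by blast
  have sub: "bicommutant (\<pi>\<^sub>1 ` S) \<subseteq> ?M"
    by (intro commutant_antimono image_mono S)
  have \<tau>_S: "\<tau> (\<pi>\<^sub>1 a) = \<pi>\<^sub>2 a" if "a \<in> S" for a
    using that S \<tau>(2) by blast
  then have "\<tau> ` \<pi>\<^sub>1 ` S = \<pi>\<^sub>2 ` S"
    by (simp add: image_image)
  then have "\<tau> ` bicommutant (\<pi>\<^sub>1 ` S) = bicommutant (\<pi>\<^sub>2 ` S)"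
    using tau_bicommutant[OF P] by simp
  moreover have "inj_on \<tau> (bicommutant (\<pi>\<^sub>1 ` S))"
    using tau_bij sub by (auto simp: bij_betw_def intro: inj_on_subset)
  ultimately have "op_star_isomorphism (bicommutant (\<pi>\<^sub>1 ` S)) (bicommutant (\<pi>\<^sub>2 ` S)) \<tau>"
    unfolding op_star_isomorphism_def bij_betw_def
    using sub tau_add tau_scale tau_comp tau_cadjoint by (auto simp: subset_iff)
  then show ?thesis
    unfolding quasi_equivalent_on_def using \<tau>_S by blast
qed

lemma op_star_isomorphism_trans:
  assumes \<sigma>: "op_star_isomorphism M N \<sigma>" and \<tau>: "op_star_isomorphism N L \<tau>"
  shows "op_star_isomorphism M L (\<tau> \<circ> \<sigma>)"
proof -
  have "\<sigma> A \<in> N" if "A \<in> M" for A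
    using that \<sigma> by (auto simp: op_star_isomorphism_def bij_betw_def)
  then show ?thesis
    using assms bij_betw_trans[of \<sigma> M N \<tau> L] by (simp add: op_star_isomorphism_def)
qed

section \<open>Conjugation by unitaries\<close>

lemma conj_in_commutant:
  assumes "bounded_op U" "bounded_op V" "V \<circ> U = id" and T: "T \<in> commutant P"
  shows "U \<circ> T \<circ> V \<in> commutant ((\<lambda>A. U \<circ> A \<circ> V) ` P)"
proof (rule commutantI)
  show "bounded_op (U \<circ> T \<circ> V)"
    by (intro bounded_op_comp assms commutant_bounded[OF T])
  have VU: "V (U x) = x" for x
    using assms(3) by (simp add: fun_eq_iff)
  show "(U \<circ> T \<circ> V) (B x) = B ((U \<circ> T \<circ> V) x)" if "B \<in> (\<lambda>A. U \<circ> A \<circ> V) ` P" for B x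
    using that commutant_commute[OF T] by (auto simp: VU)
qed

lemma commutant_conj:
  assumes U: "bounded_op U" "bounded_op V" and VU: "V \<circ> U = id" and UV: "U \<circ> V = id"
  shows "commutant ((\<lambda>A. U \<circ> A \<circ> V) ` P) = (\<lambda>A. U \<circ> A \<circ> V) ` commutant P"
proof
  have cancel: "V (U x) = x" "U (V x) = x" for x
    using VU UV by (simp_all add: fun_eq_iff)
  show "(\<lambda>A. U \<circ> A \<circ> V) ` commutant P \<subseteq> commutant ((\<lambda>A. U \<circ> A \<circ> V) ` P)"
    using conj_in_commutant[OF U VU] by blast
  show "commutant ((\<lambda>A. U \<circ> A \<circ> V) ` P) \<subseteq> (\<lambda>A. U \<circ> A \<circ> V) ` commutant P"
  proof
    fix T
    assume T: "T \<in> commutant ((\<lambda>A. U \<circ> A \<circ> V) ` P)"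
    have "(\<lambda>A. V \<circ> A \<circ> U) ` (\<lambda>A. U \<circ> A \<circ> V) ` P = P"
      by (simp add: image_image comp_def cancel)
    then have "V \<circ> T \<circ> U \<in> commutant P"
      using conj_in_commutant[OF U(2,1) UV T] by simp
    moreover have "T = U \<circ> (V \<circ> T \<circ> U) \<circ> V"
      by (simp add: comp_def cancel)
    ultimately show "T \<in> (\<lambda>A. U \<circ> A \<circ> V) ` commutant P"
      by blast
  qed
qed

lemma op_star_isomorphism_conj:
  assumes U: "bounded_op U" and VU: "cadjoint U \<circ> U = id" and M: "\<And>A. A \<in> M \<Longrightarrow> bounded_op A"
  shows "op_star_isomorphism M ((\<lambda>A. U \<circ> A \<circ> cadjoint U) ` M) (\<lambda>A. U \<circ> A \<circ> cadjoint U)"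
proof -
  note V = bounded_op_cadjoint[OF U]
  have cancel: "cadjoint U (U x) = x" for x
    using VU by (simp add: fun_eq_iff)
  have "inj_on (\<lambda>A. U \<circ> A \<circ> cadjoint U) M"
  proof (rule inj_onI)
    fix A B
    assume "U \<circ> A \<circ> cadjoint U = U \<circ> B \<circ> cadjoint U"
    then have "cadjoint U ((U \<circ> A \<circ> cadjoint U) (U x)) = cadjoint U ((U \<circ> B \<circ> cadjoint U) (U x))" for x
      by simp
    then show "A = B"
      by (simp add: cancel fun_eq_iff)
  qed
  moreover have "cadjoint (U \<circ> A \<circ> cadjoint U) = U \<circ> cadjoint A \<circ> cadjoint U" if "A \<in> M" for A
    by (simp only: cadjoint_comp bounded_op_comp U V M[OF that] cadjoint_cadjoint comp_assoc)
  ultimately show ?thesis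
    unfolding op_star_isomorphism_def bij_betw_def
    by (simp add: comp_def cancel bounded_opD(2,5)[OF U])
qed

text \<open>In each representation \<open>Ad u\<close> is implemented by a unitary, which conjugates
  the bicommutant as well. The new isomorphism undoes the conjugation on the first space, applies
  \<tau>, and redoes it on the second.\<close>

lemma quasi_equivalent_on_Ad:
  fixes \<pi>\<^sub>1 :: "'a::cstar_algebra \<Rightarrow> 'h::chilbert_space \<Rightarrow> 'h" and \<pi>\<^sub>2 :: "'a \<Rightarrow> 'k::chilbert_space \<Rightarrow> 'k"
  assumes \<pi>\<^sub>1: "star_representation \<pi>\<^sub>1" and \<pi>\<^sub>2: "star_representation \<pi>\<^sub>2"
    and u: "unitary_element u" and qe: "quasi_equivalent_on S \<pi>\<^sub>1 \<pi>\<^sub>2"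
  shows "quasi_equivalent_on (Ad u ` S) \<pi>\<^sub>1 \<pi>\<^sub>2"
proof -
  have unit: "\<pi> u \<circ> cadjoint (\<pi> u) = id" "cadjoint (\<pi> u) \<circ> \<pi> u = id"
    if "star_representation \<pi>" for \<pi> :: "'a \<Rightarrow> 'x::chilbert_space \<Rightarrow> 'x"
    using u star_representationD(2)[OF that, symmetric] star_representation_one[OF that]
    by (simp_all add: star_representationD(3)[OF that] unitary_element_def)
  have Ad_img: "\<pi> ` Ad u ` S = (\<lambda>A. \<pi> u \<circ> A \<circ> cadjoint (\<pi> u)) ` \<pi> ` S"
    if "star_representation \<pi>" for \<pi> :: "'a \<Rightarrow> 'x::chilbert_space \<Rightarrow> 'x"
    by (simp add: image_image Ad_def star_representationD(2,3)[OF that])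
  let ?c1 = "\<lambda>A. \<pi>\<^sub>1 u \<circ> A \<circ> cadjoint (\<pi>\<^sub>1 u)" and ?c2 = "\<lambda>A. \<pi>\<^sub>2 u \<circ> A \<circ> cadjoint (\<pi>\<^sub>2 u)"
  \<comment> \<open>This inverts \<open>?c1\<close>; the double adjoint gives it the shape of
    \<open>op_star_isomorphism_conj\<close> for the operator
    \<open>cadjoint (\<pi>\<^sub>1 u)\<close>.\<close>
  let ?d1 = "\<lambda>A. cadjoint (\<pi>\<^sub>1 u) \<circ> A \<circ> cadjoint (cadjoint (\<pi>\<^sub>1 u))"
  note op1 = star_representationD(1)[OF \<pi>\<^sub>1, of u] and op2 = star_representationD(1)[OF \<pi>\<^sub>2, of u]
  have bic: "bicommutant (\<pi> ` Ad u ` S) = (\<lambda>A. \<pi> u \<circ> A \<circ> cadjoint (\<pi> u)) ` bicommutant (\<pi> ` S)"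
    if "star_representation \<pi>" for \<pi> :: "'a \<Rightarrow> 'x::chilbert_space \<Rightarrow> 'x"
    by (simp only: Ad_img[OF that] commutant_conj[OF star_representationD(1)[OF that]
          bounded_op_cadjoint[OF star_representationD(1)[OF that]] unit(2,1)[OF that]])
  have d1_c1: "?d1 (?c1 A) = A" for A
    using unit(2)[OF \<pi>\<^sub>1] by (simp add: cadjoint_cadjoint[OF op1] fun_eq_iff)
  obtain \<tau> where \<tau>: "op_star_isomorphism (bicommutant (\<pi>\<^sub>1 ` S)) (bicommutant (\<pi>\<^sub>2 ` S)) \<tau>"
    "\<And>a. a \<in> S \<Longrightarrow> \<tau> (\<pi>\<^sub>1 a) = \<pi>\<^sub>2 a"
    using qe by (auto simp: quasi_equivalent_on_def)
  have "op_star_isomorphism (bicommutant (\<pi>\<^sub>1 ` Ad u ` S)) (?d1 ` bicommutant (\<pi>\<^sub>1 ` Ad u ` S)) ?d1"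
    by (rule op_star_isomorphism_conj[OF bounded_op_cadjoint[OF op1] _ commutant_bounded])
      (simp_all add: cadjoint_cadjoint[OF op1] unit[OF \<pi>\<^sub>1])
  also have "?d1 ` bicommutant (\<pi>\<^sub>1 ` Ad u ` S) = bicommutant (\<pi>\<^sub>1 ` S)"
  proof -
    have "?d1 ` ?c1 ` X = X" for X
      by (simp only: image_image d1_c1 image_ident)
    then show ?thesis
      unfolding bic[OF \<pi>\<^sub>1] .
  qed
  finally have iso1: "op_star_isomorphism (bicommutant (\<pi>\<^sub>1 ` Ad u ` S)) (bicommutant (\<pi>\<^sub>1 ` S)) ?d1" .
  have iso2: "op_star_isomorphism (bicommutant (\<pi>\<^sub>2 ` S)) (bicommutant (\<pi>\<^sub>2 ` Ad u ` S)) ?c2"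
    unfolding bic[OF \<pi>\<^sub>2] by (rule op_star_isomorphism_conj[OF op2 unit(2)[OF \<pi>\<^sub>2] commutant_bounded])
  have "op_star_isomorphism (bicommutant (\<pi>\<^sub>1 ` Ad u ` S)) (bicommutant (\<pi>\<^sub>2 ` Ad u ` S))
      (?c2 \<circ> (\<tau> \<circ> ?d1))"
    by (rule op_star_isomorphism_trans[OF op_star_isomorphism_trans[OF iso1 \<tau>(1)] iso2])
  moreover have "(?c2 \<circ> (\<tau> \<circ> ?d1)) (\<pi>\<^sub>1 b) = \<pi>\<^sub>2 b" if b: "b \<in> Ad u ` S" for b
  proof -
    obtain a where a: "a \<in> S" "b = Ad u a"
      using b by blast
    have "\<pi>\<^sub>1 b = ?c1 (\<pi>\<^sub>1 a)" "\<pi>\<^sub>2 b = ?c2 (\<pi>\<^sub>2 a)"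
      by (simp_all add: a(2) Ad_def star_representationD(2,3)[OF \<pi>\<^sub>1] star_representationD(2,3)[OF \<pi>\<^sub>2])
    then show ?thesis
      using d1_c1[of "\<pi>\<^sub>1 a"] \<tau>(2)[OF a(1)] by simp
  qed
  ultimately show ?thesis
    unfolding quasi_equivalent_on_def by blast
qed

lemma quasi_equivalent_on_comp:
  "quasi_equivalent_on S (\<pi>\<^sub>1 \<circ> \<alpha>) (\<pi>\<^sub>2 \<circ> \<alpha>) \<longleftrightarrow> quasi_equivalent_on (\<alpha> ` S) \<pi>\<^sub>1 \<pi>\<^sub>2"
  by (simp add: quasi_equivalent_on_def image_comp)

section \<open>Local algebras\<close>

lemma restrict_eq_iff: "restrict f A = restrict g A \<longleftrightarrow> (\<forall>x\<in>A. f x = g x)"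
  by (auto simp: fun_eq_iff restrict_def)

lemma spin_config_eqI:
  "\<sigma> \<in> spin_configs d \<Lambda> \<Longrightarrow> \<tau> \<in> spin_configs d \<Lambda> \<Longrightarrow> (\<And>x. x \<in> \<Lambda> \<Longrightarrow> \<sigma> x = \<tau> x) \<Longrightarrow> \<sigma> = \<tau>"
  unfolding spin_configs_def by (rule PiE_ext)

lemma finite_spin_configs: "finite \<Lambda> \<Longrightarrow> finite (spin_configs d \<Lambda>)"
  by (simp add: spin_configs_def finite_PiE)

lemma restrict_spin_config: "\<sigma> \<in> spin_configs d \<Lambda> \<Longrightarrow> A \<subseteq> \<Lambda> \<Longrightarrow> restrict \<sigma> A \<in> spin_configs d A"
  by (auto simp: spin_configs_def PiE_iff)

definition matrix_unit :: "spin_config \<Rightarrow> spin_config \<Rightarrow> spin_matrix" where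
  "matrix_unit \<sigma> \<tau> = (\<lambda>\<sigma>' \<tau>'. if \<sigma>' = \<sigma> \<and> \<tau>' = \<tau> then 1 else 0)"

lemma spin_matricesI:
  "(\<And>\<sigma> \<tau>. \<sigma> \<notin> spin_configs d \<Lambda> \<or> \<tau> \<notin> spin_configs d \<Lambda> \<Longrightarrow> M \<sigma> \<tau> = 0) \<Longrightarrow> M \<in> spin_matrices d \<Lambda>"
  by (auto simp: spin_matrices_def)

lemma spin_matricesD:
  "M \<in> spin_matrices d \<Lambda> \<Longrightarrow> \<sigma> \<notin> spin_configs d \<Lambda> \<or> \<tau> \<notin> spin_configs d \<Lambda> \<Longrightarrow> M \<sigma> \<tau> = 0"
  by (auto simp: spin_matrices_def)

lemma matrix_unit_in:
  "\<sigma> \<in> spin_configs d \<Lambda> \<Longrightarrow> \<tau> \<in> spin_configs d \<Lambda> \<Longrightarrow> matrix_unit \<sigma> \<tau> \<in> spin_matrices d \<Lambda>"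
  by (simp add: matrix_unit_def spin_matrices_def)

lemma spin_matrix_extend_in: "spin_matrix_extend d \<Lambda> \<Lambda>' M \<in> spin_matrices d \<Lambda>'"
  by (auto simp: spin_matrix_extend_def spin_matrices_def)

lemma spin_matrix_mult_in:
  assumes "M \<in> spin_matrices d \<Lambda>" "N \<in> spin_matrices d \<Lambda>"
  shows "spin_matrix_mult d \<Lambda> M N \<in> spin_matrices d \<Lambda>"
  using spin_matricesD[OF assms(1)] spin_matricesD[OF assms(2)]
  by (intro spin_matricesI) (auto simp: spin_matrix_mult_def intro!: sum.neutral)

text \<open>Matrix units over a disjoint union are elementary tensors. This reduces a tensor product
  automorphism on local elements to its defining property on products.\<close>

lemma matrix_unit_factor:
  assumes fin: "finite (A \<union> B)" and disj: "A \<inter> B = {}"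
    and \<sigma>: "\<sigma> \<in> spin_configs d (A \<union> B)" and \<tau>: "\<tau> \<in> spin_configs d (A \<union> B)"
  shows "spin_matrix_mult d (A \<union> B)
      (spin_matrix_extend d A (A \<union> B) (matrix_unit (restrict \<sigma> A) (restrict \<tau> A)))
      (spin_matrix_extend d B (A \<union> B) (matrix_unit (restrict \<sigma> B) (restrict \<tau> B))) = matrix_unit \<sigma> \<tau>"
    (is "spin_matrix_mult d ?C ?E ?F = _")
proof (intro ext)
  fix s t
  \<comment> \<open>The only intermediate configuration that contributes: the factor on
    \<open>A\<close> has already turned \<sigma> into \<tau> there, while the sites of
    \<open>B\<close> still carry \<sigma>.\<close>
  define \<rho>\<^sub>0 where "\<rho>\<^sub>0 = (\<lambda>x. if x \<in> A then \<tau> x else \<sigma> x)"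
  have \<rho>\<^sub>0: "\<rho>\<^sub>0 \<in> spin_configs d ?C"
    using \<sigma> \<tau> by (auto simp: spin_configs_def \<rho>\<^sub>0_def PiE_iff extensional_def)
  have diff: "?C - A = B" "?C - B = A"
    using disj by auto
  have "?E s \<rho> * ?F \<rho> t = (if \<rho> = \<rho>\<^sub>0 then matrix_unit \<sigma> \<tau> s t else 0)"
    if \<rho>: "\<rho> \<in> spin_configs d ?C" for \<rho>
  proof (cases "s \<in> spin_configs d ?C \<and> t \<in> spin_configs d ?C")
    case False
    then have "?E s \<rho> * ?F \<rho> t = 0" "matrix_unit \<sigma> \<tau> s t = 0"
      using \<sigma> \<tau> by (auto simp: spin_matrix_extend_def matrix_unit_def)
    then show ?thesis
      by (simp only: if_cancel)
  next
    case True
    have eqs: "s = \<sigma> \<longleftrightarrow> (\<forall>x\<in>?C. s x = \<sigma> x)" "t = \<tau> \<longleftrightarrow> (\<forall>x\<in>?C. t x = \<tau> x)"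
      "\<rho> = \<rho>\<^sub>0 \<longleftrightarrow> (\<forall>x\<in>?C. \<rho> x = \<rho>\<^sub>0 x)"
      using spin_config_eqI[of _ d ?C] True \<sigma> \<tau> \<rho> \<rho>\<^sub>0 by blast+
    have cond: "(\<forall>x\<in>B. s x = \<rho> x) \<and> (\<forall>x\<in>A. s x = \<sigma> x) \<and> (\<forall>x\<in>A. \<rho> x = \<tau> x) \<and>
        (\<forall>x\<in>A. \<rho> x = t x) \<and> (\<forall>x\<in>B. \<rho> x = \<sigma> x) \<and> (\<forall>x\<in>B. t x = \<tau> x) \<longleftrightarrow>
        \<rho> = \<rho>\<^sub>0 \<and> s = \<sigma> \<and> t = \<tau>"
    proof -
      have "(\<forall>x\<in>B. \<rho>\<^sub>0 x = \<sigma> x) \<and> (\<forall>x\<in>A. \<rho>\<^sub>0 x = \<tau> x)"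
        using disj by (auto simp: \<rho>\<^sub>0_def disjoint_iff)
      then show ?thesis
        unfolding eqs ball_Un by (intro iffI conjI ballI; elim conjE; simp)
    qed
    have "?E s \<rho> * ?F \<rho> t = (if (\<forall>x\<in>B. s x = \<rho> x) \<and> (\<forall>x\<in>A. s x = \<sigma> x) \<and> (\<forall>x\<in>A. \<rho> x = \<tau> x) \<and>
        (\<forall>x\<in>A. \<rho> x = t x) \<and> (\<forall>x\<in>B. \<rho> x = \<sigma> x) \<and> (\<forall>x\<in>B. t x = \<tau> x) then 1 else 0)"
      using True \<rho> by (simp add: spin_matrix_extend_def matrix_unit_def diff restrict_eq_iff)
    then show ?thesis
      unfolding cond by (simp add: matrix_unit_def)
  qed
  then have "spin_matrix_mult d ?C ?E ?F s t =
      (\<Sum>\<rho>\<in>spin_configs d ?C. if \<rho> = \<rho>\<^sub>0 then matrix_unit \<sigma> \<tau> s t else 0)"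
    unfolding spin_matrix_mult_def by (intro sum.cong refl) blast
  also have "\<dots> = matrix_unit \<sigma> \<tau> s t"
    using finite_spin_configs[OF fin] \<rho>\<^sub>0 by (simp add: sum.delta')
  finally show "spin_matrix_mult d ?C ?E ?F s t = matrix_unit \<sigma> \<tau> s t" .
qed

context spin_system
begin

section \<open>Region algebras as closed unital *-subalgebras\<close>

abbreviation alg :: "site set \<Rightarrow> 'a set" where
  "alg \<equiv> alg_of_region d \<iota>"

lemma local_in_alg: "finite \<Lambda>\<^sub>0 \<Longrightarrow> \<Lambda>\<^sub>0 \<subseteq> \<Lambda> \<Longrightarrow> M \<in> spin_matrices d \<Lambda>\<^sub>0 \<Longrightarrow> \<iota> \<Lambda>\<^sub>0 M \<in> alg \<Lambda>"
  unfolding alg_of_region_def by (rule subsetD[OF closure_subset]) blast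

lemma alg_subset:
  assumes "closed C" "\<And>\<Lambda>\<^sub>0 M. finite \<Lambda>\<^sub>0 \<Longrightarrow> \<Lambda>\<^sub>0 \<subseteq> \<Lambda> \<Longrightarrow> M \<in> spin_matrices d \<Lambda>\<^sub>0 \<Longrightarrow> \<iota> \<Lambda>\<^sub>0 M \<in> C"
  shows "alg \<Lambda> \<subseteq> C"
  unfolding alg_of_region_def using assms by (intro closure_minimal) auto

lemma closed_alg: "closed (alg \<Lambda>)"
  by (simp add: alg_of_region_def)

lemma alg_mono: "\<Lambda> \<subseteq> \<Lambda>' \<Longrightarrow> alg \<Lambda> \<subseteq> alg \<Lambda>'"
  by (intro alg_subset closed_alg local_in_alg) auto

lemma alg_one: "1 \<in> alg \<Lambda>"
proof -
  have "spin_matrix_one d {} \<in> spin_matrices d {}"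
    by (simp add: spin_matrix_one_def spin_matrices_def)
  then show ?thesis
    using local_in_alg[of "{}" \<Lambda> "spin_matrix_one d {}"] embed_one[of "{}"] by simp
qed

text \<open>It suffices to treat local elements: for continuous \<open>f\<close>, the elements \<open>b\<close> with \<open>f a b \<in> alg \<Lambda>\<close>
  form a closed set, and likewise for \<open>a\<close>.\<close>

lemma alg_binary:
  assumes cont: "\<And>a. continuous_on UNIV (f a)" "\<And>b. continuous_on UNIV (\<lambda>a. f a b)"
    and local: "\<And>F M N. finite F \<Longrightarrow> F \<subseteq> \<Lambda> \<Longrightarrow> M \<in> spin_matrices d F \<Longrightarrow> N \<in> spin_matrices d F \<Longrightarrow>
      f (\<iota> F M) (\<iota> F N) \<in> alg \<Lambda>"
    and ab: "a \<in> alg \<Lambda>" "b \<in> alg \<Lambda>"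
  shows "f a b \<in> alg \<Lambda>"
proof -
  have loc: "f (\<iota> F M) (\<iota> G N) \<in> alg \<Lambda>"
    if "finite F" "F \<subseteq> \<Lambda>" "M \<in> spin_matrices d F" "finite G" "G \<subseteq> \<Lambda>" "N \<in> spin_matrices d G" for F G M N
  proof -
    have "f (\<iota> (F \<union> G) (spin_matrix_extend d F (F \<union> G) M)) (\<iota> (F \<union> G) (spin_matrix_extend d G (F \<union> G) N))
        \<in> alg \<Lambda>"
      by (rule local) (use that in \<open>auto simp: spin_matrix_extend_in\<close>)
    then show ?thesis
      using embed_inclusion[of "F \<union> G" F M] embed_inclusion[of "F \<union> G" G N] that by simp
  qed
  have "alg \<Lambda> \<subseteq> f a' -` alg \<Lambda>" if "finite F" "F \<subseteq> \<Lambda>" "M \<in> spin_matrices d F" "a' = \<iota> F M" for F M a'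
  proof (rule alg_subset)
    show "closed (f a' -` alg \<Lambda>)"
      by (rule closed_vimage[OF closed_alg cont(1)])
  qed (use loc that in auto)
  then have "alg \<Lambda> \<subseteq> (\<lambda>a. f a b) -` alg \<Lambda>"
    using ab(2) by (intro alg_subset closed_vimage[OF closed_alg cont(2)]) blast
  then show ?thesis
    using ab(1) by blast
qed

lemma alg_mult: "a \<in> alg \<Lambda> \<Longrightarrow> b \<in> alg \<Lambda> \<Longrightarrow> a * b \<in> alg \<Lambda>"
proof (rule alg_binary[where f = "(*)"])
  fix F M N
  assume F: "finite F" "F \<subseteq> \<Lambda>" and M: "M \<in> spin_matrices d F" and N: "N \<in> spin_matrices d F"
  show "\<iota> F M * \<iota> F N \<in> alg \<Lambda>"
    using local_in_alg[OF F spin_matrix_mult_in[OF M N]] embed_mult[OF F(1) M N] by simp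
qed (intro continuous_intros)+

lemma alg_add: "a \<in> alg \<Lambda> \<Longrightarrow> b \<in> alg \<Lambda> \<Longrightarrow> a + b \<in> alg \<Lambda>"
proof (rule alg_binary[where f = "(+)"])
  fix F M N
  assume F: "finite F" "F \<subseteq> \<Lambda>" and M: "M \<in> spin_matrices d F" and N: "N \<in> spin_matrices d F"
  have "(\<lambda>\<sigma> \<tau>. M \<sigma> \<tau> + N \<sigma> \<tau>) \<in> spin_matrices d F"
    by (intro spin_matricesI) (simp only: spin_matricesD[OF M] spin_matricesD[OF N] add_0)
  then show "\<iota> F M + \<iota> F N \<in> alg \<Lambda>"
    using local_in_alg[OF F] embed_add[OF F(1) M N] by metis
qed (intro continuous_intros)+

text \<open>Scaling is multiplication by \<open>c *\<^sub>C 1\<close>, which is local already for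
  the empty region, so closure under products applies.\<close>

lemma alg_scale:
  assumes "a \<in> alg \<Lambda>"
  shows "c *\<^sub>C a \<in> alg \<Lambda>"
proof -
  have "c *\<^sub>C 1 \<in> alg \<Lambda>"
  proof -
    have one: "spin_matrix_one d {} \<in> spin_matrices d {}"
      by (simp add: spin_matrix_one_def spin_matrices_def)
    then have "(\<lambda>\<sigma> \<tau>. c * spin_matrix_one d {} \<sigma> \<tau>) \<in> spin_matrices d {}"
      by (auto simp: spin_matrices_def)
    then show ?thesis
      using local_in_alg[of "{}" \<Lambda>] embed_scale[OF _ one, of c] embed_one[of "{}"] by fastforce
  qed
  then show ?thesis
    using alg_mult[OF _ assms, of "c *\<^sub>C 1"] by (simp add: mult_scaleC_left)
qed

lemma alg_adj:
  assumes "a \<in> alg \<Lambda>"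
  shows "adj a \<in> alg \<Lambda>"
proof -
  have "alg \<Lambda> \<subseteq> adj -` alg \<Lambda>"
  proof (rule alg_subset)
    show "closed (adj -` alg \<Lambda>)"
      by (intro closed_vimage closed_alg linear_continuous_on bounded_linear_adj)
    fix F M
    assume F: "finite F" "F \<subseteq> \<Lambda>" and M: "M \<in> spin_matrices d F"
    have "(\<lambda>\<sigma> \<tau>. cnj (M \<tau> \<sigma>)) \<in> spin_matrices d F"
      using M by (auto simp: spin_matrices_def)
    then show "\<iota> F M \<in> adj -` alg \<Lambda>"
      using local_in_alg[OF F] embed_adj[OF F(1) M] by fastforce
  qed
  then show ?thesis
    using assms by blast
qed

section \<open>Expansion in matrix units and images of regions under factorized
  automorphisms\<close>

lemma embed_sum:
  assumes F: "finite F" and "finite I" and M: "\<And>i. i \<in> I \<Longrightarrow> M i \<in> spin_matrices d F"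
  shows "\<iota> F (\<lambda>\<sigma> \<tau>. \<Sum>i\<in>I. M i \<sigma> \<tau>) = (\<Sum>i\<in>I. \<iota> F (M i))"
  using \<open>finite I\<close> M
proof (induction I rule: finite_induct)
  case empty
  have "spin_matrix_one d F \<in> spin_matrices d F"
    by (simp add: spin_matrix_one_def spin_matrices_def)
  then show ?case
    using embed_scale[OF F, of "spin_matrix_one d F" 0] by simp
next
  case (insert i I)
  have "(\<lambda>\<sigma> \<tau>. \<Sum>i\<in>I. M i \<sigma> \<tau>) \<in> spin_matrices d F"
    by (intro spin_matricesI sum.neutral ballI) (rule spin_matricesD[OF insert.prems], simp_all)
  then show ?case
    using insert embed_add[OF F, of "M i" "\<lambda>\<sigma> \<tau>. \<Sum>i\<in>I. M i \<sigma> \<tau>"] by simp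
qed

lemma embed_eq_sum_matrix_units:
  assumes F: "finite F" and M: "M \<in> spin_matrices d F"
  shows "\<iota> F M = (\<Sum>(\<sigma>, \<tau>)\<in>spin_configs d F \<times> spin_configs d F. M \<sigma> \<tau> *\<^sub>C \<iota> F (matrix_unit \<sigma> \<tau>))"
proof -
  let ?C = "spin_configs d F \<times> spin_configs d F"
  have fin: "finite ?C"
    using finite_spin_configs[OF F] by simp
  have unit: "matrix_unit (fst p) (snd p) \<in> spin_matrices d F" if "p \<in> ?C" for p
    using that by (auto intro: matrix_unit_in)
  have "M = (\<lambda>s t. \<Sum>p\<in>?C. M (fst p) (snd p) * matrix_unit (fst p) (snd p) s t)"
  proof (intro ext)
    fix s t
    have "(\<Sum>p\<in>?C. M (fst p) (snd p) * matrix_unit (fst p) (snd p) s t)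
        = (\<Sum>p\<in>?C. if p = (s, t) then M s t else 0)"
      by (intro sum.cong) (auto simp: matrix_unit_def)
    also have "\<dots> = (if (s, t) \<in> ?C then M s t else 0)"
      by (simp add: sum.delta' fin del: mem_Sigma_iff)
    also have "\<dots> = M s t"
      using M by (auto simp: spin_matrices_def)
    finally show "M s t = (\<Sum>p\<in>?C. M (fst p) (snd p) * matrix_unit (fst p) (snd p) s t)" ..
  qed
  then have "\<iota> F M = \<iota> F (\<lambda>s t. \<Sum>p\<in>?C. M (fst p) (snd p) * matrix_unit (fst p) (snd p) s t)"
    by simp
  also have "\<dots> = (\<Sum>p\<in>?C. \<iota> F (\<lambda>s t. M (fst p) (snd p) * matrix_unit (fst p) (snd p) s t))"
    by (rule embed_sum[OF F fin]) (use unit in \<open>auto simp: spin_matrices_def\<close>)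
  also have "\<dots> = (\<Sum>p\<in>?C. M (fst p) (snd p) *\<^sub>C \<iota> F (matrix_unit (fst p) (snd p)))"
    by (intro sum.cong refl embed_scale[OF F] unit)
  finally show ?thesis
    by (simp add: case_prod_beta)
qed

lemma embed_matrix_unit_factor:
  assumes fin: "finite (A \<union> B)" and disj: "A \<inter> B = {}"
    and \<sigma>: "\<sigma> \<in> spin_configs d (A \<union> B)" and \<tau>: "\<tau> \<in> spin_configs d (A \<union> B)"
  shows "\<iota> (A \<union> B) (matrix_unit \<sigma> \<tau>) = \<iota> A (matrix_unit (restrict \<sigma> A) (restrict \<tau> A)) *
    \<iota> B (matrix_unit (restrict \<sigma> B) (restrict \<tau> B))"
  unfolding matrix_unit_factor[OF assms, symmetric]
    embed_mult[OF fin spin_matrix_extend_in spin_matrix_extend_in]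
  by (intro arg_cong2[of _ _ _ _ "(*)"] embed_inclusion fin matrix_unit_in restrict_spin_config[OF \<sigma>]
      restrict_spin_config[OF \<tau>]) auto

text \<open>Only the sites of \<open>X\<close> can be added to \<open>Y\<close>. Each matrix unit
  over a finite part of \<open>Y\<close> splits into a factor inside \<open>X\<close>, which \<Xi>
  keeps in the algebra of \<open>X\<close>, and a factor outside, which is left alone. Linearity and
  continuity of \<Xi>' extend this to the closure.\<close>

lemma tensor_automorphism_image:
  assumes \<Xi>: "star_automorphism_on (alg X) \<Xi>" and \<Xi>': "is_tensor_automorphism d \<iota> X \<Xi> id \<Xi>'"
    and "X \<subseteq> Z" "Y \<subseteq> Z" and r: "r \<in> alg Y"
  shows "\<Xi>' r \<in> alg Z"
proof -
  have aut: "star_automorphism_on UNIV \<Xi>'"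
    and tensor: "\<And>a b. a \<in> alg X \<Longrightarrow> b \<in> alg (- X) \<Longrightarrow> \<Xi>' (a * b) = \<Xi> a * b"
    using \<Xi>' by (auto simp: is_tensor_automorphism_def)
  note lin = bounded_linear_star_automorphism[OF aut]
  have "alg Y \<subseteq> \<Xi>' -` alg Z"
  proof (rule alg_subset)
    show "closed (\<Xi>' -` alg Z)"
      by (intro closed_vimage closed_alg linear_continuous_on lin)
    fix F M
    assume F: "finite F" "F \<subseteq> Y" and M: "M \<in> spin_matrices d F"
    define A B where "A = F \<inter> X" and "B = F - X"
    have AB: "A \<union> B = F" "A \<inter> B = {}" "finite A" "finite B" "A \<subseteq> X" "B \<subseteq> - X" "B \<subseteq> Z"
      using F \<open>Y \<subseteq> Z\<close> by (auto simp: A_def B_def)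
    have unit: "\<Xi>' (\<iota> F (matrix_unit \<sigma> \<tau>)) \<in> alg Z"
      if \<sigma>: "\<sigma> \<in> spin_configs d F" and \<tau>: "\<tau> \<in> spin_configs d F" for \<sigma> \<tau>
    proof -
      define a b where "a = \<iota> A (matrix_unit (restrict \<sigma> A) (restrict \<tau> A))"
        and "b = \<iota> B (matrix_unit (restrict \<sigma> B) (restrict \<tau> B))"
      have units: "matrix_unit (restrict \<sigma> A) (restrict \<tau> A) \<in> spin_matrices d A"
        "matrix_unit (restrict \<sigma> B) (restrict \<tau> B) \<in> spin_matrices d B"
        using \<sigma> \<tau> AB(1) by (auto intro!: matrix_unit_in restrict_spin_config)
      have a: "a \<in> alg X" and b: "b \<in> alg (- X)" "b \<in> alg Z"
        unfolding a_def b_def using AB units by (auto intro: local_in_alg)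
      have "\<iota> F (matrix_unit \<sigma> \<tau>) = a * b"
        unfolding a_def b_def using embed_matrix_unit_factor[of A B \<sigma> \<tau>] \<sigma> \<tau> F(1) AB(1,2) by simp
      then have "\<Xi>' (\<iota> F (matrix_unit \<sigma> \<tau>)) = \<Xi> a * b"
        using tensor[OF a b(1)] by simp
      moreover have "\<Xi> a \<in> alg Z"
        using star_automorphismD(1)[OF \<Xi>] a alg_mono[OF \<open>X \<subseteq> Z\<close>] by (auto simp: bij_betw_def)
      ultimately show ?thesis
        using alg_mult b(2) by simp
    qed
    have zero: "0 \<in> alg Z"
      using alg_scale[OF alg_one, of 0] by simp
    have "\<Xi>' (\<iota> F M) = (\<Sum>(\<sigma>, \<tau>)\<in>spin_configs d F \<times> spin_configs d F. M \<sigma> \<tau> *\<^sub>C \<Xi>' (\<iota> F (matrix_unit \<sigma> \<tau>)))"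
      unfolding embed_eq_sum_matrix_units[OF F(1) M] linear_sum[OF bounded_linear.linear[OF lin]]
      by (intro sum.cong refl) (auto simp: star_automorphismD(3)[OF aut])
    also have "\<dots> \<in> alg Z"
    proof -
      have sum_in: "(\<Sum>p\<in>I. f p) \<in> alg Z" if "finite I" "\<And>p. p \<in> I \<Longrightarrow> f p \<in> alg Z"
        for I and f :: "spin_config \<times> spin_config \<Rightarrow> 'a"
        using that by (induction I rule: finite_induct) (auto simp: zero alg_add)
      show ?thesis
        by (rule sum_in) (auto intro: finite_spin_configs[OF F(1)] unit alg_scale)
    qed
    finally show "\<iota> F M \<in> \<Xi>' -` alg Z"
      by simp
  qed
  then show ?thesis
    using r by blast
qed

text \<open>Since \<beta> acts on \<open>1 * b\<close> through the second factor, it preserves the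
  algebra of \<open>- \<Lambda>\<close>. Both \<open>- \<Lambda>\<close> and
  \<open>\<Gamma>\<^sub>2 - \<Gamma>\<^sub>1\<close> lie in \<open>- \<Gamma>\<^sub>1\<close>, so
  \<Xi>' does not lead out of that region.\<close>

lemma quasi_factorizable_image:
  assumes "quasi_factorizable d \<iota> \<alpha> \<Gamma>\<^sub>1 \<Lambda> \<Gamma>\<^sub>2" and \<Gamma>: "\<Gamma>\<^sub>1 \<subseteq> \<Lambda>"
  obtains u S where "unitary_element u" "S \<subseteq> alg (- \<Gamma>\<^sub>1)" "\<alpha> ` alg (- \<Lambda>) = Ad u ` S"
proof -
  obtain u \<alpha>\<^sub>\<Lambda> \<alpha>\<^sub>\<Lambda>\<^sub>c \<Xi> \<beta> \<Xi>' where u: "unitary_element u"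
    and \<alpha>\<^sub>\<Lambda>: "star_automorphism_on (alg \<Lambda>) \<alpha>\<^sub>\<Lambda>" and \<alpha>\<^sub>\<Lambda>\<^sub>c: "star_automorphism_on (alg (- \<Lambda>)) \<alpha>\<^sub>\<Lambda>\<^sub>c"
    and \<Xi>: "star_automorphism_on (alg (\<Gamma>\<^sub>2 - \<Gamma>\<^sub>1)) \<Xi>"
    and \<beta>: "is_tensor_automorphism d \<iota> \<Lambda> \<alpha>\<^sub>\<Lambda> \<alpha>\<^sub>\<Lambda>\<^sub>c \<beta>"
    and \<Xi>': "is_tensor_automorphism d \<iota> (\<Gamma>\<^sub>2 - \<Gamma>\<^sub>1) \<Xi> id \<Xi>'" and \<alpha>: "\<alpha> = Ad u \<circ> \<Xi>' \<circ> \<beta>"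
    using assms(1) unfolding quasi_factorizable_def by blast
  have "\<beta> b \<in> alg (- \<Lambda>)" if b: "b \<in> alg (- \<Lambda>)" for b
  proof -
    have "\<beta> (1 * b) = \<alpha>\<^sub>\<Lambda> 1 * \<alpha>\<^sub>\<Lambda>\<^sub>c b"
      using \<beta> b alg_one[of \<Lambda>] unfolding is_tensor_automorphism_def by blast
    then have "\<beta> b = \<alpha>\<^sub>\<Lambda>\<^sub>c b"
      using star_automorphism_one[OF \<alpha>\<^sub>\<Lambda> alg_one] by simp
    then show ?thesis
      using star_automorphismD(1)[OF \<alpha>\<^sub>\<Lambda>\<^sub>c] b by (auto simp: bij_betw_def)
  qed
  then have sub: "\<Xi>' ` \<beta> ` alg (- \<Lambda>) \<subseteq> alg (- \<Gamma>\<^sub>1)"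
    using tensor_automorphism_image[OF \<Xi> \<Xi>', of "- \<Gamma>\<^sub>1" "- \<Lambda>"] \<Gamma> by blast
  have image: "\<alpha> ` alg (- \<Lambda>) = Ad u ` \<Xi>' ` \<beta> ` alg (- \<Lambda>)"
    by (simp add: \<alpha> image_comp)
  show thesis
    by (rule that[OF u sub image])
qed

end

theorem theorem4p7:
  fixes d :: "site \<Rightarrow> nat"
    and \<iota> :: "site set \<Rightarrow> spin_matrix \<Rightarrow> 'a::cstar_algebra"
    and \<pi>\<^sub>0 :: "'a \<Rightarrow> 'k::chilbert_space \<Rightarrow> 'k"
    and \<pi> :: "'a \<Rightarrow> 'h::chilbert_space \<Rightarrow> 'h"
    and \<alpha> :: "'a \<Rightarrow> 'a"
  assumes "spin_system d \<iota>"
    and "star_representation \<pi>\<^sub>0"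
    and "quasi_local_automorphism d \<iota> \<alpha>"
    and "\<And>\<Lambda>. is_cone \<Lambda> \<Longrightarrow>
           \<exists>\<Gamma>\<^sub>1 \<Gamma>\<^sub>2. is_cone \<Gamma>\<^sub>1 \<and> is_cone \<Gamma>\<^sub>2 \<and> \<Gamma>\<^sub>1 \<subseteq> \<Lambda> \<and> \<Lambda> \<subseteq> \<Gamma>\<^sub>2 \<and>
             quasi_factorizable d \<iota> \<alpha> \<Gamma>\<^sub>1 \<Lambda> \<Gamma>\<^sub>2"
    and "star_representation \<pi>"
    and "superselection_criterion d \<iota> \<pi>\<^sub>0 \<pi>"
  shows "superselection_criterion d \<iota> (\<pi>\<^sub>0 \<circ> \<alpha>) (\<pi> \<circ> \<alpha>)"
  unfolding superselection_criterion_def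
proof (intro allI impI)
  fix \<Lambda>
  assume "is_cone \<Lambda>"
  then obtain \<Gamma>\<^sub>1 \<Gamma>\<^sub>2 where \<Gamma>: "is_cone \<Gamma>\<^sub>1" "\<Gamma>\<^sub>1 \<subseteq> \<Lambda>" "quasi_factorizable d \<iota> \<alpha> \<Gamma>\<^sub>1 \<Lambda> \<Gamma>\<^sub>2"
    using assms(4) by blast
  interpret spin_system d \<iota>
    by (rule assms(1))
  obtain u S where u: "unitary_element u" and S: "S \<subseteq> alg (- \<Gamma>\<^sub>1)"
    and image: "\<alpha> ` alg (- \<Lambda>) = Ad u ` S"
    by (rule quasi_factorizable_image[OF \<Gamma>(3,2)])
  \<comment> \<open>The criterion is invoked at the smaller cone \<open>\<Gamma>\<^sub>1\<close>, as
    \<Xi>' may carry elements out of the algebra of \<open>- \<Lambda>\<close>.\<close>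
  have qe: "quasi_equivalent_on (alg (- \<Gamma>\<^sub>1)) \<pi> \<pi>\<^sub>0"
    using assms(6) \<Gamma>(1) by (simp add: superselection_criterion_def)
  have "quasi_equivalent_on S \<pi> \<pi>\<^sub>0"
    by (rule quasi_equivalent_on_subset[OF assms(5,2) _ S qe]) (rule alg_adj)
  then show "quasi_equivalent_on (alg (- \<Lambda>)) (\<pi> \<circ> \<alpha>) (\<pi>\<^sub>0 \<circ> \<alpha>)"
    unfolding quasi_equivalent_on_comp image by (rule quasi_equivalent_on_Ad[OF assms(5,2) u])
qed

end
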